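(* Let $n\ge3$ and let $P_n$ be the path on $\{x_1,\ldots,x_n\}$ with edges $\{x_1,x_2\},\{x_2,x_3\},\ldots,\{x_{n-1},x_n\}$. The Gorenstein polytopes in $\mathbb{R}^n$ of the form $\operatorname{conv}(\mathcal{D}(P_n,\mathfrak{c}))$ with $\mathfrak{c}\in(\mathbb{Z}_{>0})^n$ are exactly the following: (1) if $n\ge4$ is even: $\mathcal{Q}_n$ and $\mathcal{Q}_n'+(1,\ldots,1)$; (2) if $n=5$: the four polytopes in $\mathbb{R}^5$ defined respectively by (i) $0\le x_i\le1$ for $1\le i\le5$ and $x_1+x_3+x_5\le2$; (ii) $0\le x_i\le1$ for $i=1,2,4,5$, $0\le x_3$, and $x_1+x_3+x_5\le2$; (iii) $0\le x_i\le2$ for $1\le i\le5$ and $x_1+x_3+x_5\le4$; (iv) $0\le x_i\le2$ for $i=1,2,4,5$, $0\le x_3$, and $x_1+x_3+x_5\le4$. (In particular, there are none when $n$ is odd and $n\ne5$.)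
   Context: Let $n\ge 3$ and let $G$ be a finite graph on the vertex set $V(G)=\{x_1,\ldots,x_n\}$ with no loops, no multiple edges and no isolated vertices. Let $S=K[x_1,\ldots,x_n]$ be the polynomial ring over a field $K$ and let $I(G)\subset S$ be the edge ideal, generated by the monomials $x_ix_j$ with $\{x_i,x_j\}\in E(G)$. For $\mathfrak{c}=(c_1,\ldots,c_n)\in(\mathbb{Z}_{>0})^n$ and an integer $q\ge1$, $(I(G)^q)_{\mathfrak{c}}$ is the ideal generated by the monomials $x_1^{a_1}\cdots x_n^{a_n}\in I(G)^q$ with $a_i\le c_i$ for all $i$. Let $\delta_{\mathfrak{c}}(I(G))$ be the largest $q$ with $(I(G)^q)_{\mathfrak{c}}\ne(0)$, and let $\mathcal{B}(G,\mathfrak{c})$ be the minimal set of monomial generators of $(I(G)^{\delta_{\mathfrak{c}}(I(G))})_{\mathfrak{c}}$. Let $\mathcal{D}(G,\mathfrak{c})$ be the set of vectors $(a_1,\ldots,a_n)\in\mathbb{Z}_{\ge0}^n$ such that $x_1^{a_1}\cdots x_n^{a_n}$ divides some $u\in\mathcal{B}(G,\mathfrak{c})$, and let $\operatorname{conv}(\mathcal{D}(G,\mathfrak{c}))\subset\mathbb{R}^n$ be its convex hull. A lattice polytope (all vertices in $\mathbb{Z}^n$) $\mathcal{P}\subset\mathbb{R}^n$ of dimension $n$ is reflexive if the origin lies in its interior and its dual $\mathcal{P}^\vee=\{x\in\mathbb{R}^n:\sum_i x_iy_i\le1\ \forall y\in\mathcal{P}\}$ is a lattice polytope. A lattice polytope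 $\mathcal{P}\subset\mathbb{R}^n$ of dimension $n$ is Gorenstein if there are an integer $\delta>0$ and $\mathbf{a}\in\mathbb{Z}^n$ such that $\delta\mathcal{P}-\mathbf{a}$ is reflexive. $\mathcal{Q}_n=[0,1]^n\subset\mathbb{R}^n$ is the standard unit cube and $\mathcal{Q}_n'=2\mathcal{Q}_n-(1,\ldots,1)=[-1,1]^n$, so $\mathcal{Q}_n'+(1,\ldots,1)=[0,2]^n$. *)

theory Defs
  imports "HOL-Analysis.Analysis" "HOL-Library.Poly_Mapping"
begin

text \<open>The polynomial ring over a field in variables indexed by a finite type: monomials are
  exponent functions, and multiplication of polynomials is the convolution product provided by
  the library.\<close>

type_synonym ('v, 'k) mpoly = "('v \<Rightarrow>\<^sub>0 nat) \<Rightarrow>\<^sub>0 'k"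

definition mpoly_monom :: "('v \<Rightarrow>\<^sub>0 nat) \<Rightarrow> ('v, 'k::field) mpoly" where
  "mpoly_monom a = Poly_Mapping.single a 1"

definition mpoly_var :: "'v \<Rightarrow> ('v, 'k::field) mpoly" where
  "mpoly_var i = mpoly_monom (Poly_Mapping.single i 1)"

text \<open>A commutative ring is a module over itself, and its submodules are its ideals.\<close>

definition ideal_gen :: "'r::comm_ring_1 set \<Rightarrow> 'r set" where
  "ideal_gen B = module.span (*) B"

lemma module_self: "module ((*) :: 'r::comm_ring_1 \<Rightarrow> 'r \<Rightarrow> 'r)"
  by unfold_locales (simp_all add: algebra_simps)

lemma ideal_gen_explicit:
  "ideal_gen B = {\<Sum>b\<in>T. r b * b | T r. finite T \<and> T \<subseteq> (B :: 'r::comm_ring_1 set)}"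
  by (simp add: ideal_gen_def module.span_explicit[OF module_self])

definition ideal_mult :: "'r::comm_ring_1 set \<Rightarrow> 'r set \<Rightarrow> 'r set" where
  "ideal_mult I J = ideal_gen {a * b | a b. a \<in> I \<and> b \<in> J}"

primrec ideal_power :: "'r::comm_ring_1 set \<Rightarrow> nat \<Rightarrow> 'r set" where
  "ideal_power I 0 = UNIV"
| "ideal_power I (Suc q) = ideal_mult I (ideal_power I q)"

text \<open>A graph is given by its set of edges, each edge being the set of its two end points.\<close>

definition edge_ideal :: "'v set set \<Rightarrow> ('v, 'k::field) mpoly set" where
  "edge_ideal E = ideal_gen {mpoly_var i * mpoly_var j | i j. {i, j} \<in> E}"

definition bounded_part :: "nat ^ 'n::finite \<Rightarrow> ('n, 'k::field) mpoly set \<Rightarrow> ('n, 'k) mpoly set" where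
  "bounded_part c J =
     ideal_gen {mpoly_monom a | a. mpoly_monom a \<in> J \<and> (\<forall>i. Poly_Mapping.lookup a i \<le> c $ i)}"

definition delta :: "nat ^ 'n::finite \<Rightarrow> ('n, 'k::field) mpoly set \<Rightarrow> nat" where
  "delta c I = (GREATEST q. 1 \<le> q \<and> bounded_part c (ideal_power I q) \<noteq> {0})"

definition is_min_monom_gens :: "('v, 'k::field) mpoly set \<Rightarrow> ('v, 'k) mpoly set \<Rightarrow> bool" where
  "is_min_monom_gens J B \<longleftrightarrow>
     B \<subseteq> range mpoly_monom \<and> ideal_gen B = J \<and> (\<forall>B'. B' \<subset> B \<longrightarrow> ideal_gen B' \<noteq> J)"

text \<open>The description is proper for every monomial ideal, by \<open>ex1_min_monom_gens\<close> below.\<close>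

definition min_monom_gens :: "('v, 'k::field) mpoly set \<Rightarrow> ('v, 'k) mpoly set" where
  "min_monom_gens J = (THE B. is_min_monom_gens J B)"

lemma monom_add: "mpoly_monom (a + b) = mpoly_monom a * mpoly_monom b"
  by (simp add: mpoly_monom_def Poly_Mapping.mult_single)

lemma monom_in_ideal_gen:
  assumes "mpoly_monom a \<in> ideal_gen (mpoly_monom ` A :: ('v, 'k::field) mpoly set)"
  shows "\<exists>b\<in>A. \<exists>t. a = b + t"
proof -
  interpret module "(*) :: ('v, 'k) mpoly \<Rightarrow> _" by (rule module_self)
  have "\<forall>m\<in>Poly_Mapping.keys p. \<exists>b\<in>A. \<exists>t. m = b + t"
    if "p \<in> span (mpoly_monom ` A)" for p :: "('v, 'k) mpoly"
    using that
  proof (induction rule: span_induct_alt)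
    case (step c x y)
    then obtain b where b: "b \<in> A" "x = mpoly_monom b" by blast
    have "Poly_Mapping.keys (c * x) \<subseteq> {m. \<exists>t. m = b + t}"
      using Poly_Mapping.keys_mult[of c x] unfolding b mpoly_monom_def
      by (auto simp: add.commute split: if_splits)
    with step b Poly_Mapping.keys_add[of "c * x" y] show ?case by blast
  qed auto
  from this[OF assms[unfolded ideal_gen_def]] show ?thesis by (simp add: mpoly_monom_def)
qed

lemma ideal_gen_monom_dvd:
  assumes "mpoly_monom b \<in> ideal_gen B"
  shows "mpoly_monom (b + t) \<in> ideal_gen (B :: ('v, 'k::field) mpoly set)"
  using module.span_scale[OF module_self, of "mpoly_monom b" B "mpoly_monom t"] assms
  by (simp add: ideal_gen_def monom_add mult.commute)

lemma ideal_gen_subset: "B \<subseteq> ideal_gen C \<Longrightarrow> ideal_gen B \<subseteq> ideal_gen (C :: 'r::comm_ring_1 set)"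
  by (simp add: ideal_gen_def module.span_minimal[OF module_self] module.subspace_span[OF module_self])

lemma ideal_gen_base: "b \<in> B \<Longrightarrow> b \<in> ideal_gen (B :: 'r::comm_ring_1 set)"
  by (simp add: ideal_gen_def module.span_base[OF module_self])

lemma min_monom_gens_le:
  assumes "is_min_monom_gens J B" "is_min_monom_gens J (C :: ('v, 'k::field) mpoly set)"
  shows "B \<subseteq> C"
proof
  fix p assume p: "p \<in> B"
  obtain A A' where A: "B = mpoly_monom ` A" and A': "C = mpoly_monom ` A'"
    using assms unfolding is_min_monom_gens_def by (meson subset_imageE)
  from p A obtain b where b: "b \<in> A" "p = mpoly_monom b" by auto
  have "mpoly_monom b \<in> ideal_gen C"
    using assms p b ideal_gen_base[of p B] by (simp add: is_min_monom_gens_def)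
  then obtain b' t where b': "b' \<in> A'" "b = b' + t"
    using monom_in_ideal_gen A' by metis
  have "mpoly_monom b' \<in> ideal_gen B"
    using assms b' A' ideal_gen_base[of "mpoly_monom b'" C] by (simp add: is_min_monom_gens_def)
  then obtain b'' s where b'': "b'' \<in> A" "b' = b'' + s"
    using monom_in_ideal_gen A by metis
  have "b'' = b"
  proof (rule ccontr)
    assume ne: "b'' \<noteq> b"
    have "mpoly_monom b'' \<noteq> p"
      using ne b by (auto simp: mpoly_monom_def dest: arg_cong[of _ _ Poly_Mapping.keys])
    then have "mpoly_monom b'' \<in> ideal_gen (B - {p})" using b'' A by (auto intro: ideal_gen_base)
    then have "p \<in> ideal_gen (B - {p})"
      using ideal_gen_monom_dvd[of b'' "B - {p}" "s + t"] b b' b'' by (simp add: add.assoc)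
    then have "B \<subseteq> ideal_gen (B - {p})" using ideal_gen_base[of _ "B - {p}"] by blast
    then have "ideal_gen (B - {p}) = ideal_gen B"
      using ideal_gen_base[of _ B] by (intro antisym ideal_gen_subset) auto
    moreover have "B - {p} \<subset> B" using p by blast
    ultimately show False using assms(1) unfolding is_min_monom_gens_def by metis
  qed
  with b' b'' have "b + (s + t) = b + 0" by (metis add.assoc add.right_neutral)
  then have "s + t = 0" by (rule add_left_imp_eq)
  then have "Poly_Mapping.lookup t i = 0" for i
    by (metis add_is_0 lookup_add lookup_zero)
  then have "t = 0" by (intro poly_mapping_eqI) simp
  then show "p \<in> C" using b b' A' by simp
qed

lemma ex1_min_monom_gens:
  fixes A :: "('v::finite \<Rightarrow>\<^sub>0 nat) set"
  shows "\<exists>!B. is_min_monom_gens (ideal_gen (mpoly_monom ` A) :: ('v, 'k::field) mpoly set) B"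
proof -
  define M where "M = {a \<in> A. \<forall>b\<in>A. \<forall>t. a = b + t \<longrightarrow> t = 0}"
  have below: "\<exists>b\<in>M. \<exists>t. a = b + t" if "a \<in> A" for a
    using that
  proof (induction "\<Sum>i\<in>UNIV. Poly_Mapping.lookup a i" arbitrary: a rule: less_induct)
    case less
    show ?case
    proof (cases "a \<in> M")
      case True
      then show ?thesis by (intro bexI[of _ a] exI[of _ 0]) auto
    next
      case False
      with less.prems obtain b t where bt: "b \<in> A" "a = b + t" "t \<noteq> 0" by (auto simp: M_def)
      from bt(3) obtain i where i: "0 < Poly_Mapping.lookup t i"
        by (auto simp: poly_mapping_eq_iff fun_eq_iff)
      have "(\<Sum>i\<in>UNIV. Poly_Mapping.lookup b i) < (\<Sum>i\<in>UNIV. Poly_Mapping.lookup a i)"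
        unfolding bt(2) lookup_add
        by (rule sum_strict_mono_ex1) (use i in auto)
      from less.hyps[OF this bt(1)] obtain b' s where "b' \<in> M" "b = b' + s" by blast
      with bt(2) have "a = b' + (s + t)" by (simp add: add.assoc)
      with \<open>b' \<in> M\<close> show ?thesis by blast
    qed
  qed
  let ?B = "mpoly_monom ` M :: ('v, 'k) mpoly set"
  have "M \<subseteq> A" by (auto simp: M_def)
  have 1: "ideal_gen ?B = ideal_gen (mpoly_monom ` A)"
  proof (intro antisym ideal_gen_subset subsetI)
    fix x :: "('v, 'k) mpoly" assume "x \<in> mpoly_monom ` A"
    then obtain a where a: "a \<in> A" "x = mpoly_monom a" by blast
    from below[OF a(1)] obtain b t where "b \<in> M" "a = b + t" by blast
    moreover from this have "mpoly_monom b \<in> ideal_gen ?B"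
      by (simp add: ideal_gen_base)
    ultimately show "x \<in> ideal_gen ?B" using a by (simp add: ideal_gen_monom_dvd)
  qed (use \<open>M \<subseteq> A\<close> in \<open>auto intro: ideal_gen_base\<close>)
  have "is_min_monom_gens (ideal_gen (mpoly_monom ` A)) ?B"
    unfolding is_min_monom_gens_def
  proof (intro conjI allI impI notI)
    fix B' assume B': "B' \<subset> ?B" "ideal_gen B' = ideal_gen (mpoly_monom ` A)"
    then obtain N where N: "N \<subseteq> M" "B' = mpoly_monom ` N" by (meson psubset_imp_subset subset_imageE)
    with B' obtain m where m: "m \<in> M" "m \<notin> N" by blast
    have "mpoly_monom m \<in> ideal_gen (mpoly_monom ` N :: ('v, 'k) mpoly set)"
      using ideal_gen_base[of "mpoly_monom m" "mpoly_monom ` A :: ('v, 'k) mpoly set"] m \<open>M \<subseteq> A\<close> B' N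
      by (auto simp: image_iff)
    then obtain b t where b: "b \<in> N" "m = b + t" using monom_in_ideal_gen by blast
    with m N \<open>M \<subseteq> A\<close> have "t = 0" unfolding M_def by blast
    with b m show False by simp
  qed (use 1 in auto)
  then show ?thesis using min_monom_gens_le by blast
qed

definition B_gens :: "'n::finite set set \<Rightarrow> nat ^ 'n \<Rightarrow> ('n, 'k::field) mpoly set" where
  "B_gens E c =
     (let I = edge_ideal E :: ('n, 'k) mpoly set
      in min_monom_gens (bounded_part c (ideal_power I (delta c I))))"

text \<open>The field cannot be read off from the result, so the remaining notions take it as a type
  argument.\<close>

definition D_vectors :: "'k::field itself \<Rightarrow> 'n::finite set set \<Rightarrow> nat ^ 'n \<Rightarrow> (real ^ 'n) set" where
  "D_vectors _ E c =
     {\<chi> i. real (Poly_Mapping.lookup a i) | a.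
        \<exists>u \<in> (B_gens E c :: ('n, 'k) mpoly set). mpoly_monom a dvd u}"

definition lattice_polytope :: "(real ^ 'n) set \<Rightarrow> bool" where
  "lattice_polytope P \<longleftrightarrow> polytope P \<and> (\<forall>v. v extreme_point_of P \<longrightarrow> (\<forall>i. v $ i \<in> \<int>))"

definition dual_polytope :: "(real ^ 'n) set \<Rightarrow> (real ^ 'n) set" where
  "dual_polytope P = {x. \<forall>y\<in>P. (\<Sum>i\<in>UNIV. x $ i * y $ i) \<le> 1}"

definition reflexive_polytope :: "(real ^ 'n) set \<Rightarrow> bool" where
  "reflexive_polytope P \<longleftrightarrow>
     lattice_polytope P \<and> aff_dim P = int CARD('n) \<and> 0 \<in> interior P \<and>
     lattice_polytope (dual_polytope P)"

definition gorenstein_polytope :: "(real ^ 'n) set \<Rightarrow> bool" where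
  "gorenstein_polytope P \<longleftrightarrow>
     lattice_polytope P \<and> aff_dim P = int CARD('n) \<and>
     (\<exists>(d::int) (a::real ^ 'n). d > 0 \<and> (\<forall>i. a $ i \<in> \<int>) \<and>
        reflexive_polytope ((\<lambda>y. of_int d *\<^sub>R y - a) ` P))"

text \<open>The path whose successive vertices are \<open>x 1, \<dots>, x n\<close>, where \<open>n\<close> is the size of
  the index type.\<close>

definition path_edges :: "(nat \<Rightarrow> 'n::finite) \<Rightarrow> 'n set set" where
  "path_edges x = {{x i, x (Suc i)} | i. 1 \<le> i \<and> i < CARD('n)}"

definition gorenstein_D_polytopes :: "'k::field itself \<Rightarrow> 'n::finite set set \<Rightarrow> (real ^ 'n) set set" where
  "gorenstein_D_polytopes K E =
     {P. gorenstein_polytope P \<and>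
         (\<exists>c. (\<forall>i. c $ i > 0) \<and> P = convex hull (D_vectors K E c))}"

definition unit_cube :: "(real ^ 'n) set" where
  "unit_cube = {y. \<forall>i. 0 \<le> y $ i \<and> y $ i \<le> 1}"

definition centred_cube :: "(real ^ 'n) set" where
  "centred_cube = (\<lambda>y. 2 *\<^sub>R y - (\<chi> i. 1)) ` unit_cube"

end

theory Submission
  imports Defs
begin

text \<open>The generators of highest power are the degree vectors of the maximum \<open>c\<close>-matchings of the path,
  and by a Mendelsohn--Dulmage exchange argument a vector lies below one of them iff its odd and even
  coordinates can separately be covered by \<open>c\<close>-matchings. If \<open>d P - a\<close> is reflexive, every facet
  \<open>y(T) \<le> h\<close> of \<open>P\<close> has lattice distance \<open>1\<close> from the origin after the translation; the facets
  \<open>y\<^sub>i \<ge> 0\<close> give \<open>a = (1, \<dots>, 1)\<close>, and so \<open>d h = |T| + 1\<close>. The singletons \<open>T = {i}\<close>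
  then force all inner capacities to equal \<open>r = 2 / d \<in> {1, 2}\<close>, up to the exception
  \<open>c\<^sub>3 \<ge> 2 r\<close> for \<open>n = 5\<close>, and for odd \<open>n\<close> the set of all odd vertices is a facet that leaves
  only \<open>n = 5\<close>.\<close>

section \<open>Powers of edge ideals\<close>

text \<open>Every edge of a path has one odd and one even end, so the total weight can be read off
  from either colour class alone; this is why odd and even degrees may come from different
  weightings without losing maximality. The delicate point is which inequalities are facets. An end
  vertex has a single neighbour, so \<open>y_3 \<le> c_3\<close> gives way as soon as
  \<open>c_3 \<ge> c_2 + c_4\<close>. For \<open>n \<noteq> 5\<close> the facet of
  \<open>{1, 3}\<close> takes over and demands \<open>d (c_2 + c_4) = 3\<close>, against
  \<open>d c_2 = d c_4 = 2\<close> (for \<open>n = 3\<close>, where \<open>c_4\<close> counts as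
  \<open>0\<close>, it demands \<open>d c_2 = 3\<close> against \<open>2\<close>). For
  \<open>n = 5\<close> both ends interfere, and the set \<open>{1, 3, 5}\<close> demands
  \<open>d (c_2 + c_4) = 4 = 2 + 2\<close>, which is consistent: hence the exceptional polytopes
  with a large third capacity.\<close>

lemma keys_mpoly_monom: "Poly_Mapping.keys (mpoly_monom a :: ('v, 'k::field) mpoly) = {a}"
  by (simp add: mpoly_monom_def)

lemma mpoly_monom_nonzero [simp]: "(mpoly_monom a :: ('v, 'k::field) mpoly) \<noteq> 0"
  by (metis keys_mpoly_monom keys_zero insert_not_empty)

lemma monom_in_ideal_gen_iff:
  "(mpoly_monom a :: ('v, 'k::field) mpoly) \<in> ideal_gen (mpoly_monom ` A)
     \<longleftrightarrow> (\<exists>b\<in>A. \<exists>t. a = b + t)"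
  by (metis ideal_gen_base ideal_gen_monom_dvd imageI monom_in_ideal_gen)

lemma ideal_gen_monom_eq_zero_iff:
  "ideal_gen (mpoly_monom ` A :: ('v, 'k::field) mpoly set) = {0} \<longleftrightarrow> A = {}"
proof
  assume "ideal_gen (mpoly_monom ` A :: ('v, 'k::field) mpoly set) = {0}"
  then have "mpoly_monom a \<notin> (mpoly_monom ` A :: ('v, 'k::field) mpoly set)" for a
    using ideal_gen_base[of "mpoly_monom a" "mpoly_monom ` A :: ('v, 'k) mpoly set"] by auto
  then show "A = {}" by blast
qed (simp add: ideal_gen_def module.span_empty[OF module_self])

lemma mpoly_monom_dvd_iff:
  "(mpoly_monom a :: ('v, 'k::field) mpoly) dvd mpoly_monom b \<longleftrightarrow> (\<exists>t. b = a + t)"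
proof
  assume "(mpoly_monom a :: ('v, 'k::field) mpoly) dvd mpoly_monom b"
  then obtain q where "(mpoly_monom b :: ('v, 'k::field) mpoly) = q * mpoly_monom a"
    by (auto simp: dvd_def mult.commute)
  moreover have "q * mpoly_monom a \<in> ideal_gen (mpoly_monom ` {a} :: ('v, 'k::field) mpoly set)"
    unfolding ideal_gen_def
    by (simp add: module.span_scale[OF module_self] module.span_base[OF module_self])
  ultimately show "\<exists>t. b = a + t"
    by (metis monom_in_ideal_gen singletonD)
qed (auto simp: monom_add)

text \<open>Bilinearity, by span induction in one factor at a time. It lets powers of the edge ideal
  be computed on generators.\<close>

lemma ideal_mult_ideal_gen:
  "ideal_mult (ideal_gen B) (ideal_gen C) = ideal_gen {b * c |b c. b \<in> B \<and> c \<in> C}"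
    for B C :: "'r::comm_ring_1 set"
proof -
  interpret m: module "(*) :: 'r \<Rightarrow> 'r \<Rightarrow> 'r" by (rule module_self)
  let ?S = "{b * c |b c. b \<in> B \<and> c \<in> C}"
  have *: "b * z \<in> m.span ?S" if "b \<in> B" "z \<in> m.span C" for b z
    using that(2)
  proof (induction rule: m.span_induct_alt)
    case (step r y z)
    have "r * (b * y) \<in> m.span ?S" using step that by (intro m.span_scale m.span_base) auto
    moreover have "b * (r * y + z) = r * (b * y) + b * z" by (simp only: distrib_left mult.left_commute)
    ultimately show ?case using step by (simp add: m.span_add)
  qed (simp add: m.span_zero)
  have "a * z \<in> m.span ?S" if "a \<in> m.span B" "z \<in> m.span C" for a z
    using that(1)
  proof (induction rule: m.span_induct_alt)
    case (step r y a)
    have "r * (y * z) \<in> m.span ?S" using *[OF step(1) that(2)] by (rule m.span_scale)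
    moreover have "(r * y + a) * z = r * (y * z) + a * z" by (simp only: distrib_right mult.assoc)
    ultimately show ?case using step by (simp add: m.span_add)
  qed (simp add: m.span_zero)
  then show ?thesis
    unfolding ideal_mult_def
    by (intro antisym ideal_gen_subset subsetI) (fastforce simp: ideal_gen_def intro: m.span_base)+
qed

primrec edge_sums :: "'v set set \<Rightarrow> nat \<Rightarrow> ('v \<Rightarrow>\<^sub>0 nat) set" where
  "edge_sums E 0 = {0}"
| "edge_sums E (Suc q) =
     {Poly_Mapping.single i 1 + Poly_Mapping.single j 1 + b | i j b. {i, j} \<in> E \<and> b \<in> edge_sums E q}"

lemma ideal_power_edge_ideal:
  "ideal_power (edge_ideal E :: ('v, 'k::field) mpoly set) q = ideal_gen (mpoly_monom ` edge_sums E q)"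
proof (induction q)
  case 0
  have "(mpoly_monom 0 :: ('v, 'k) mpoly) = 1" by (simp add: mpoly_monom_def)
  then have "z \<in> ideal_gen {mpoly_monom 0}" for z :: "('v, 'k) mpoly"
    using module.span_scale[OF module_self, of 1 "{1}" z]
    by (simp add: ideal_gen_def module.span_base[OF module_self])
  then show ?case by auto
next
  case (Suc q)
  have "{b * c |b c. b \<in> {mpoly_var i * mpoly_var j |i j. {i, j} \<in> E} \<and> c \<in> mpoly_monom ` edge_sums E q}
    = (mpoly_monom ` edge_sums E (Suc q) :: ('v, 'k) mpoly set)"
    by (force simp: mpoly_var_def monom_add[symmetric])
  then show ?case
    unfolding ideal_power.simps Suc unfolding edge_ideal_def ideal_mult_ideal_gen by simp
qed

definition bounded_edge_sums :: "'n::finite set set \<Rightarrow> nat ^ 'n \<Rightarrow> nat \<Rightarrow> ('n \<Rightarrow>\<^sub>0 nat) set" where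
  "bounded_edge_sums E c q = {b \<in> edge_sums E q. \<forall>i. Poly_Mapping.lookup b i \<le> c $ i}"

text \<open>A monomial of the power that respects \<open>c\<close> is a multiple of a product of
  \<open>q\<close> edges, and a divisor of a bounded monomial is bounded too.\<close>

lemma bounded_part_power:
  "bounded_part c (ideal_power (edge_ideal E :: ('n::finite, 'k::field) mpoly set) q)
     = ideal_gen (mpoly_monom ` bounded_edge_sums E c q)"
  unfolding bounded_part_def
proof (intro antisym ideal_gen_subset subsetI)
  fix p :: "('n, 'k) mpoly"
  assume "p \<in> {mpoly_monom a |a. mpoly_monom a \<in> ideal_power (edge_ideal E :: ('n, 'k) mpoly set) q
                 \<and> (\<forall>i. Poly_Mapping.lookup a i \<le> c $ i)}"
  then obtain a where p: "p = mpoly_monom a" and a: "\<forall>i. Poly_Mapping.lookup a i \<le> c $ i"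
    and "mpoly_monom a \<in> ideal_power (edge_ideal E :: ('n, 'k) mpoly set) q" by blast
  then obtain b t where b: "b \<in> edge_sums E q" "a = b + t"
    by (auto simp: ideal_power_edge_ideal monom_in_ideal_gen_iff)
  have "\<forall>i. Poly_Mapping.lookup b i \<le> c $ i"
    using a unfolding b(2) lookup_add by (meson add_leD1)
  with b p show "p \<in> ideal_gen (mpoly_monom ` bounded_edge_sums E c q)"
    by (auto simp: monom_in_ideal_gen_iff bounded_edge_sums_def)
qed (auto simp: ideal_power_edge_ideal bounded_edge_sums_def intro!: ideal_gen_base)

text \<open>No member divides another one, so dropping a member loses it; uniqueness is
  \<open>min_monom_gens_le\<close>.\<close>

lemma min_monom_gens_antichain:
  assumes "\<And>a b t. a \<in> A \<Longrightarrow> b \<in> A \<Longrightarrow> a = b + t \<Longrightarrow> t = 0"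
  shows "min_monom_gens (ideal_gen (mpoly_monom ` A :: ('v, 'k::field) mpoly set)) = mpoly_monom ` A"
  unfolding min_monom_gens_def
proof (rule the_equality)
  show *: "is_min_monom_gens (ideal_gen (mpoly_monom ` A)) (mpoly_monom ` A :: ('v, 'k) mpoly set)"
    unfolding is_min_monom_gens_def
  proof (intro conjI allI impI notI)
    fix B :: "('v, 'k) mpoly set"
    assume B: "B \<subset> mpoly_monom ` A" "ideal_gen B = ideal_gen (mpoly_monom ` A)"
    then obtain N where N: "N \<subseteq> A" "B = mpoly_monom ` N"
      by (meson psubset_imp_subset subset_imageE)
    with B obtain m where m: "m \<in> A" "m \<notin> N" by blast
    then have "mpoly_monom m \<in> ideal_gen (mpoly_monom ` N :: ('v, 'k) mpoly set)"
      using B N by (simp add: ideal_gen_base)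
    then obtain b t where "b \<in> N" "m = b + t" using monom_in_ideal_gen by blast
    with assms m N show False by (metis add.right_neutral subsetD)
  qed auto
  show "B = mpoly_monom ` A"
    if "is_min_monom_gens (ideal_gen (mpoly_monom ` A :: ('v, 'k) mpoly set)) B" for B
    using min_monom_gens_le[OF that *] min_monom_gens_le[OF * that] by blast
qed

text \<open>Products of \<open>q\<close> edges all have the same degree, so none properly divides
  another and the bounded ones form an antichain; the degree also bounds the powers that survive
  below \<open>c\<close>.\<close>

lemma edge_sums_degree:
  "b \<in> edge_sums E q \<Longrightarrow> (\<Sum>i\<in>UNIV. Poly_Mapping.lookup b (i::'n::finite)) = 2 * q"
proof (induction q arbitrary: b)
  case (Suc q)
  then obtain i j b' where "b = Poly_Mapping.single i 1 + Poly_Mapping.single j 1 + b'"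
    "b' \<in> edge_sums E q" by auto
  moreover have "(\<Sum>k\<in>UNIV. Poly_Mapping.lookup (Poly_Mapping.single i (1::nat)) k) = 1" for i :: 'n
    by (simp add: lookup_single when_def)
  ultimately show ?case using Suc.IH[of b'] by (simp add: lookup_add sum.distrib)
qed simp

text \<open>Removes polynomials and the field: what remains is the down-set of the bounded edge sums
  of the largest possible power. The hypothesis on the first power, together with the degree bound,
  makes the \<open>GREATEST\<close> in \<open>delta\<close> meaningful.\<close>

lemma D_vectors_eq:
  fixes E :: "'n::finite set set"
  assumes "bounded_edge_sums E c 1 \<noteq> {}"
  obtains q where
    "D_vectors TYPE('k::field) E c =
       {\<chi> i. real (Poly_Mapping.lookup a i) | a. \<exists>b\<in>bounded_edge_sums E c q. \<exists>t. b = a + t}"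
    "bounded_edge_sums E c q \<noteq> {}" "\<And>p. bounded_edge_sums E c p \<noteq> {} \<Longrightarrow> p \<le> q"
proof -
  define q where "q = delta c (edge_ideal E :: ('n, 'k) mpoly set)"
  have q: "q = (GREATEST q. 1 \<le> q \<and> bounded_edge_sums E c q \<noteq> {})"
    by (simp add: q_def delta_def bounded_part_power ideal_gen_monom_eq_zero_iff)
  have le: "p \<le> (\<Sum>i\<in>UNIV. c $ i)" if p: "bounded_edge_sums E c p \<noteq> {}" for p
  proof -
    obtain b where "b \<in> edge_sums E p" "\<forall>i. Poly_Mapping.lookup b i \<le> c $ i"
      using p by (auto simp: bounded_edge_sums_def)
    then show ?thesis
      using edge_sums_degree[of b E p] sum_mono[of UNIV "Poly_Mapping.lookup b" "($) c"] by auto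
  qed
  have 1: "1 \<le> q \<and> bounded_edge_sums E c q \<noteq> {}"
    unfolding q by (rule GreatestI_nat[where k = 1]) (use assms le in auto)
  have 2: "p \<le> q" if "bounded_edge_sums E c p \<noteq> {}" for p
  \<comment> \<open>\<open>delta\<close> ranges over positive powers only, so power \<open>0\<close>
    is treated apart.\<close>
  proof (cases "p = 0")
    case False
    then show ?thesis unfolding q by (intro Greatest_le_nat) (use that le in auto)
  qed simp
  have "t = 0" if "b + t \<in> bounded_edge_sums E c q" "b \<in> bounded_edge_sums E c q" for b t
  proof -
    have "(\<Sum>i\<in>UNIV. Poly_Mapping.lookup t i) = 0"
      using that edge_sums_degree[of "b + t" E q] edge_sums_degree[of b E q]
      by (auto simp: bounded_edge_sums_def lookup_add sum.distrib)
    then show ?thesis by (intro poly_mapping_eqI) simp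
  qed
  then have "B_gens E c = (mpoly_monom ` bounded_edge_sums E c q :: ('n, 'k) mpoly set)"
    unfolding B_gens_def Let_def bounded_part_power q_def[symmetric]
    by (intro min_monom_gens_antichain) auto
  then have "D_vectors TYPE('k) E c =
       {\<chi> i. real (Poly_Mapping.lookup a i) | a. \<exists>b\<in>bounded_edge_sums E c q. \<exists>t. b = a + t}"
    by (simp add: D_vectors_def mpoly_monom_dvd_iff)
  with 1 2 that show thesis by blast
qed

section \<open>Weightings of a path\<close>

text \<open>\<open>w k\<close> is the weight of the edge from vertex \<open>k\<close> to vertex
  \<open>k + 1\<close>. The indices \<open>0\<close> and \<open>n\<close> stand for phantom edges
  beyond the two ends, on which feasible weightings vanish.\<close>

definition path_degree :: "(nat \<Rightarrow> nat) \<Rightarrow> nat \<Rightarrow> nat" where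
  "path_degree w k = w (k - 1) + w k"

definition feasible :: "nat \<Rightarrow> (nat \<Rightarrow> nat) \<Rightarrow> (nat \<Rightarrow> nat) \<Rightarrow> bool" where
  "feasible n C w \<longleftrightarrow> w 0 = 0 \<and> w n = 0 \<and> (\<forall>k\<in>{1..n}. path_degree w k \<le> C k)"

text \<open>One vertex of the exchange: primed values are weights on the incoming edge, unprimed
  ones on the outgoing edge, \<open>a' + a\<close> is the demand and \<open>c\<close> the capacity.
  Since both weightings respect \<open>c\<close>, the choices can be balanced so that the new sum
  lies between the demand and \<open>max (a' + a) (b' + b)\<close>.\<close>

lemma exchange_step:
  fixes a a' b b' c :: nat
  assumes "a' + a \<le> c" "b' + b \<le> c"
    and "b' \<le> a' \<longrightarrow> (\<forall>t\<in>{b'..a'}. R t)" "a' < b' \<longrightarrow> (\<exists>t\<in>{a'..b'}. R t)"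
  shows "a \<le> b \<Longrightarrow> \<forall>s\<in>{a..b}. \<exists>t. R t \<and> a' + a \<le> t + s \<and> t + s \<le> c"
    and "b < a \<Longrightarrow> \<exists>s\<in>{b..a}. \<exists>t. R t \<and> a' + a \<le> t + s \<and> t + s \<le> c"
proof -
  show "\<forall>s\<in>{a..b}. \<exists>t. R t \<and> a' + a \<le> t + s \<and> t + s \<le> c" if "a \<le> b"
  proof
    fix s assume s: "s \<in> {a..b}"
    show "\<exists>t. R t \<and> a' + a \<le> t + s \<and> t + s \<le> c"
    proof (cases "b' \<le> a'")
      case True
      \<comment> \<open>The smallest admissible \<open>t\<close> that meets the demand:
        \<open>t + s\<close> is then \<open>a' + a\<close>, or it is
        \<open>b' + s \<le> b' + b\<close>.\<close>
      with s have "max b' (a' + a - s) \<in> {b'..a'}" by auto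
      with assms(3) True have "R (max b' (a' + a - s))" by blast
      with s assms(1,2) show ?thesis by (intro exI[of _ "max b' (a' + a - s)"]) auto
    next
      case False
      then obtain t where "t \<in> {a'..b'}" "R t" using assms(4) by auto
      with s assms(1,2) show ?thesis by (intro exI[of _ t]) auto
    qed
  qed
  show "\<exists>s\<in>{b..a}. \<exists>t. R t \<and> a' + a \<le> t + s \<and> t + s \<le> c" if "b < a"
  proof (cases "b' \<le> a'")
    case True
    with assms(3) have "R a'" by auto
    with that assms(1) show ?thesis by (intro bexI[of _ a] exI[of _ a']) auto
  next
    case False
    then obtain t where "t \<in> {a'..b'}" "R t" using assms(4) by auto
    with that assms(1,2) show ?thesis
      by (intro bexI[of _ "max b (a' + a - t)"] exI[of _ t]) auto
  qed
qed

text \<open>A Mendelsohn--Dulmage theorem for paths. The weights are chosen from left to right; write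
  \<open>a\<close> for the weighting whose degree has to be attained at vertex \<open>i\<close> and \<open>b\<close> for the other one.
  The invariant is that every value in \<open>{a i..b i}\<close> can be reached on edge \<open>i\<close> if
  \<open>a i \<le> b i\<close>, and some value in \<open>{b i..a i}\<close> otherwise.\<close>

lemma feasible_exchange:
  assumes w1: "feasible n C w1" and w2: "feasible n C w2"
  obtains w where "feasible n C w"
    "\<And>k. k \<in> {1..n} \<Longrightarrow> odd k \<Longrightarrow> path_degree w1 k \<le> path_degree w k"
    "\<And>k. k \<in> {1..n} \<Longrightarrow> even k \<Longrightarrow> path_degree w2 k \<le> path_degree w k"
proof -
  define a where "a i = (if odd i then w1 i else w2 i)" for i
  define b where "b i = (if odd i then w2 i else w1 i)" for i
  define l where "l k = (if odd k then path_degree w1 k else path_degree w2 k)" for k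
  define reach where "reach i t \<longleftrightarrow> (\<exists>p. p 0 = 0 \<and> p i = t \<and>
     (\<forall>k\<in>{1..i}. l k \<le> path_degree p k \<and> path_degree p k \<le> C k))" for i t
  have reach_Suc: "reach (Suc i) s"
    if "reach i t" "l (Suc i) \<le> t + s" "t + s \<le> C (Suc i)" for i t s
  proof -
    obtain p where p: "p 0 = 0" "p i = t"
      "\<And>k. k \<in> {1..i} \<Longrightarrow> l k \<le> path_degree p k \<and> path_degree p k \<le> C k"
      using \<open>reach i t\<close> by (auto simp: reach_def)
    have "path_degree (p(Suc i := s)) k = path_degree p k" if "k \<in> {1..i}" for k
      using that by (auto simp: path_degree_def)
    moreover have "path_degree (p(Suc i := s)) (Suc i) = t + s"
      using p(2) by (simp add: path_degree_def)
    ultimately show ?thesis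
      unfolding reach_def using p that(2,3)
      by (intro exI[of _ "p(Suc i := s)"]) (auto simp: atLeastAtMostSuc_conv)
  qed
  have "(a i \<le> b i \<longrightarrow> (\<forall>t\<in>{a i..b i}. reach i t)) \<and> (b i < a i \<longrightarrow> (\<exists>t\<in>{b i..a i}. reach i t))"
    if "i \<le> n" for i
    using that
  proof (induction i)
    case 0
    have "reach 0 0" by (auto simp: reach_def)
    then show ?case using w1 w2 by (auto simp: a_def b_def feasible_def)
  next
    case (Suc i)
    \<comment> \<open>Passing a vertex swaps the roles: \<open>b\<close> on the incoming edge and
      \<open>a\<close> on the outgoing edge belong to the same weighting, the one demanded at this
      vertex.\<close>
    have l: "l (Suc i) = b i + a (Suc i)"
      by (auto simp: l_def a_def b_def path_degree_def)
    have C: "path_degree w1 (Suc i) \<le> C (Suc i)" "path_degree w2 (Suc i) \<le> C (Suc i)"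
      using w1 w2 Suc.prems by (auto simp: feasible_def)
    then have 1: "b i + a (Suc i) \<le> C (Suc i)" "a i + b (Suc i) \<le> C (Suc i)"
      by (auto simp: a_def b_def path_degree_def)
    have 2: "a i \<le> b i \<longrightarrow> (\<forall>t\<in>{a i..b i}. reach i t)"
      "b i < a i \<longrightarrow> (\<exists>t\<in>{b i..a i}. reach i t)"
      using Suc by auto
    note step = exchange_step[OF 1 2]
    show ?case
    proof (intro conjI impI)
      assume "a (Suc i) \<le> b (Suc i)"
      from step(1)[OF this] show "\<forall>t\<in>{a (Suc i)..b (Suc i)}. reach (Suc i) t"
        using reach_Suc l by metis
    next
      assume "b (Suc i) < a (Suc i)"
      from step(2)[OF this] show "\<exists>t\<in>{b (Suc i)..a (Suc i)}. reach (Suc i) t"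
        using reach_Suc l by metis
    qed
  qed
  \<comment> \<open>On the phantom edge \<open>n\<close> both weightings vanish, so the interval of
    the invariant is \<open>{0}\<close>.\<close>
  from this[of n] have "reach n 0" using w1 w2 by (auto simp: a_def b_def feasible_def)
  then obtain p where "p 0 = 0" "p n = 0"
    "\<And>k. k \<in> {1..n} \<Longrightarrow> l k \<le> path_degree p k \<and> path_degree p k \<le> C k"
    by (auto simp: reach_def)
  then show thesis by (intro that[of p]) (force simp: feasible_def l_def)+
qed

text \<open>Each edge has exactly one odd end. In the induction over a prefix, the extra term is the
  edge leaving the prefix when its odd end lies inside.\<close>

lemma sum_path_degree_odd:
  "w 0 = 0 \<Longrightarrow> w n = 0 \<Longrightarrow> (\<Sum>k\<in>{1..n}. if odd k then path_degree w k else 0) = (\<Sum>k<n. w k)"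
proof -
  assume w: "w 0 = 0" "w n = 0"
  have "(\<Sum>k\<in>{1..m}. if odd k then path_degree w k else 0)
      = (\<Sum>k<m. w k) + (if odd m then w m else 0)" for m
    by (induction m) (auto simp: path_degree_def)
  with w show ?thesis by simp
qed

lemma sum_path_degree_even:
  "w 0 = 0 \<Longrightarrow> w n = 0 \<Longrightarrow> (\<Sum>k\<in>{1..n}. if even k then path_degree w k else 0) = (\<Sum>k<n. w k)"
proof -
  assume w: "w 0 = 0" "w n = 0"
  have "(\<Sum>k\<in>{1..m}. if even k then path_degree w k else 0)
      = (\<Sum>k<m. w k) + (if even m then w m else 0)" for m
    using w(1) by (induction m) (auto simp: path_degree_def)
  with w show ?thesis by simp
qed

text \<open>A feasible weighting is maximum as soon as its degrees dominate those of a maximum one on one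
  colour class, so exchanging with a maximum weighting on either side loses nothing.\<close>

lemma maximum_feasible_exchange:
  assumes m: "feasible n C m" and max: "\<And>w. feasible n C w \<Longrightarrow> (\<Sum>k<n. w k) \<le> (\<Sum>k<n. m k)"
    and "feasible n C w1" "feasible n C w2"
  obtains w where "feasible n C w" "(\<Sum>k<n. w k) = (\<Sum>k<n. m k)"
    "\<And>k. k \<in> {1..n} \<Longrightarrow> odd k \<Longrightarrow> path_degree w1 k \<le> path_degree w k"
    "\<And>k. k \<in> {1..n} \<Longrightarrow> even k \<Longrightarrow> path_degree w2 k \<le> path_degree w k"
proof -
  obtain v where v: "feasible n C v"
    "\<And>k. k \<in> {1..n} \<Longrightarrow> odd k \<Longrightarrow> path_degree w1 k \<le> path_degree v k"
    "\<And>k. k \<in> {1..n} \<Longrightarrow> even k \<Longrightarrow> path_degree w2 k \<le> path_degree v k"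
    using feasible_exchange assms(3,4) by blast
  \<comment> \<open>\<open>u\<close> keeps the odd degrees of \<open>v\<close> but dominates
    \<open>m\<close> on the even vertices, hence is maximum. In the next exchange, \<open>w\<close>
    inherits this maximality through the odd vertices and recovers the even degrees of
    \<open>v\<close>.\<close>
  obtain u where u: "feasible n C u"
    "\<And>k. k \<in> {1..n} \<Longrightarrow> odd k \<Longrightarrow> path_degree v k \<le> path_degree u k"
    "\<And>k. k \<in> {1..n} \<Longrightarrow> even k \<Longrightarrow> path_degree m k \<le> path_degree u k"
    using feasible_exchange v(1) m by blast
  obtain w where w: "feasible n C w"
    "\<And>k. k \<in> {1..n} \<Longrightarrow> odd k \<Longrightarrow> path_degree u k \<le> path_degree w k"
    "\<And>k. k \<in> {1..n} \<Longrightarrow> even k \<Longrightarrow> path_degree v k \<le> path_degree w k"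
    using feasible_exchange u(1) v(1) by blast
  have "(\<Sum>k<n. m k) = (\<Sum>k\<in>{1..n}. if even k then path_degree m k else 0)"
    using m by (simp only: sum_path_degree_even feasible_def)
  also have "\<dots> \<le> (\<Sum>k\<in>{1..n}. if even k then path_degree u k else 0)"
    using u(3) by (intro sum_mono) auto
  also have "\<dots> = (\<Sum>k\<in>{1..n}. if odd k then path_degree u k else 0)"
    using u(1) by (simp only: sum_path_degree_even sum_path_degree_odd feasible_def)
  also have "\<dots> \<le> (\<Sum>k\<in>{1..n}. if odd k then path_degree w k else 0)"
    using w(2) by (intro sum_mono) auto
  also have "\<dots> = (\<Sum>k<n. w k)"
    using w(1) by (simp only: sum_path_degree_odd feasible_def)
  finally have "(\<Sum>k<n. w k) = (\<Sum>k<n. m k)" using max[OF w(1)] by simp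
  then show thesis
    using that[OF w(1)] w(2,3) u(2) v(2,3) by (meson order_trans)
qed

section \<open>Edge sums of a labelled path as degree vectors of weightings\<close>

locale path_labelling =
  fixes n :: nat and x :: "nat \<Rightarrow> 'n::finite"
  assumes card_n: "n = CARD('n)" and n_ge: "n \<ge> 3"
    and bij_x: "bij_betw x {1..n} UNIV"
begin

lemma x_eq_iff: "k \<in> {1..n} \<Longrightarrow> j \<in> {1..n} \<Longrightarrow> x k = x j \<longleftrightarrow> k = j"
  using bij_betw_imp_inj_on[OF bij_x] by (simp only: inj_on_eq_iff)

lemma all_x_iff: "(\<forall>i. P i) \<longleftrightarrow> (\<forall>k\<in>{1..n}. P (x k))"
proof -
  have "i \<in> x ` {1..n}" for i using bij_x by (simp add: bij_betw_def)
  then show ?thesis by (metis imageE)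
qed

lemma poly_mapping_labels_eqI:
  "(\<And>k. k \<in> {1..n} \<Longrightarrow> Poly_Mapping.lookup a (x k) = Poly_Mapping.lookup b (x k)) \<Longrightarrow> a = b"
  using all_x_iff[of "\<lambda>i. Poly_Mapping.lookup a i = Poly_Mapping.lookup b i"]
  by (blast intro: poly_mapping_eqI)

definition of_labels :: "(nat \<Rightarrow> nat) \<Rightarrow> 'n \<Rightarrow>\<^sub>0 nat" where
  "of_labels f = Abs_poly_mapping (\<lambda>i. f (inv_into {1..n} x i))"

lemma lookup_of_labels: "k \<in> {1..n} \<Longrightarrow> Poly_Mapping.lookup (of_labels f) (x k) = f k"
  unfolding of_labels_def using bij_x
  by (subst Abs_poly_mapping_inverse) (auto simp: bij_betw_def)

lemma lookup_edge:
  assumes "1 \<le> i" "i < n" "k \<in> {1..n}"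
  shows "Poly_Mapping.lookup (Poly_Mapping.single (x i) (1::nat) + Poly_Mapping.single (x (Suc i)) 1) (x k)
    = path_degree ((\<lambda>_. 0)(i := 1)) k"
  using assms x_eq_iff[of i k] x_eq_iff[of "Suc i" k]
  by (auto simp: lookup_add lookup_single when_def path_degree_def)

lemma path_edge_iff:
  "{u, v} \<in> path_edges x \<longleftrightarrow> (\<exists>i. 1 \<le> i \<and> i < n \<and> (u = x i \<and> v = x (Suc i) \<or> v = x i \<and> u = x (Suc i)))"
  by (auto simp: path_edges_def card_n doubleton_eq_iff)

text \<open>The weight of an edge is its multiplicity in the product; the induction adds or removes
  one copy of an edge.\<close>

lemma edge_sums_path_iff:
  "b \<in> edge_sums (path_edges x) q \<longleftrightarrow>
     (\<exists>w. w 0 = 0 \<and> w n = 0 \<and> (\<Sum>k<n. w k) = q \<and>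
        (\<forall>k\<in>{1..n}. Poly_Mapping.lookup b (x k) = path_degree w k))"
proof (induction q arbitrary: b)
  case 0
  show ?case (is "?l \<longleftrightarrow> ?r")
  proof
    assume ?l
    then show ?r by (intro exI[of _ "\<lambda>_. 0"]) (simp add: path_degree_def)
  next
    assume ?r
    then obtain w where w: "w n = 0" "\<forall>k<n. w k = 0"
      "\<forall>k\<in>{1..n}. Poly_Mapping.lookup b (x k) = path_degree w k" by auto
    then have "w k = 0" if "k \<le> n" for k using that le_neq_implies_less by blast
    with w(3) have "b = 0" by (intro poly_mapping_labels_eqI) (auto simp: path_degree_def)
    then show ?l by simp
  qed
next
  case (Suc q)
  show ?case (is "?l \<longleftrightarrow> ?r")
  proof
    assume ?l
    then obtain u v b' where b: "b = Poly_Mapping.single u 1 + Poly_Mapping.single v 1 + b'"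
      "{u, v} \<in> path_edges x" "b' \<in> edge_sums (path_edges x) q" by auto
    then obtain i where i: "1 \<le> i" "i < n"
      "b = Poly_Mapping.single (x i) 1 + Poly_Mapping.single (x (Suc i)) 1 + b'"
      by (auto simp: path_edge_iff add.commute)
    obtain w where w: "w 0 = 0" "w n = 0" "(\<Sum>k<n. w k) = q"
      "\<forall>k\<in>{1..n}. Poly_Mapping.lookup b' (x k) = path_degree w k"
      using Suc.IH b(3) by auto
    let ?w = "\<lambda>k. w k + ((\<lambda>_. 0)(i := 1)) k"
    have "(\<Sum>k<n. ?w k) = Suc q"
      using i w(3) by (simp add: sum.distrib fun_upd_def)
    moreover have "Poly_Mapping.lookup b (x k) = path_degree ?w k" if "k \<in> {1..n}" for k
      using lookup_edge[OF i(1,2) that] w(4) that unfolding i(3)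
      by (simp add: lookup_add path_degree_def)
    ultimately show ?r using i w by (intro exI[of _ ?w]) auto
  next
    assume ?r
    then obtain w where w: "w 0 = 0" "w n = 0" "(\<Sum>k<n. w k) = Suc q"
      "\<forall>k\<in>{1..n}. Poly_Mapping.lookup b (x k) = path_degree w k" by blast
    \<comment> \<open>A positive total leaves some edge with positive weight, and
      \<open>w 0 = 0\<close> ensures that it is a genuine edge.\<close>
    then obtain i where i: "i < n" "w i \<noteq> 0"
      by (metis lessThan_iff nat.distinct(1) sum.neutral)
    with w(1) have i1: "1 \<le> i" by (cases i) auto
    let ?w = "w(i := w i - 1)"
    define b' where "b' = of_labels (path_degree ?w)"
    have "(\<Sum>k<n. ?w k) = q"
      using w(3) i sum.remove[of "{..<n}" i w] sum.remove[of "{..<n}" i ?w]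
      by (simp add: fun_upd_def)
    then have "b' \<in> edge_sums (path_edges x) q"
      unfolding Suc.IH b'_def
      by (intro exI[of _ ?w] conjI ballI) (use w(1,2) i i1 in \<open>auto simp: lookup_of_labels\<close>)
    moreover have "b = Poly_Mapping.single (x i) 1 + Poly_Mapping.single (x (Suc i)) 1 + b'"
    proof (rule poly_mapping_labels_eqI)
      fix k assume k: "k \<in> {1..n}"
      have "path_degree w k = path_degree ((\<lambda>_. 0)(i := 1)) k + path_degree ?w k"
        using i by (auto simp: path_degree_def)
      then show "Poly_Mapping.lookup b (x k) = Poly_Mapping.lookup
          (Poly_Mapping.single (x i) 1 + Poly_Mapping.single (x (Suc i)) 1 + b') (x k)"
        unfolding lookup_add[of _ b'] lookup_edge[OF i1 i(1) k]
        using w(4) k by (simp add: b'_def lookup_of_labels)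
    qed
    moreover have "{x i, x (Suc i)} \<in> path_edges x" using i i1 path_edge_iff by blast
    ultimately show ?l unfolding edge_sums.simps by blast
  qed
qed

text \<open>The odd and the even coordinates are covered by two unrelated weightings: this is the product
  decomposition of the polytope along the two colour classes.\<close>

definition covered :: "nat ^ 'n \<Rightarrow> (nat \<Rightarrow> nat) \<Rightarrow> bool" where
  "covered c f \<longleftrightarrow> (\<exists>w1 w2. feasible n (\<lambda>k. c $ x k) w1 \<and> feasible n (\<lambda>k. c $ x k) w2 \<and>
     (\<forall>k\<in>{1..n}. f k \<le> (if odd k then path_degree w1 k else path_degree w2 k)))"

text \<open>A vector below a maximum degree vector is covered by using that weighting for both
  colours; conversely \<open>maximum_feasible_exchange\<close> merges the two covering weightings
  into a single maximum one.\<close>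

theorem D_vectors_path:
  assumes c: "\<And>i. c $ i > 0"
  shows "D_vectors TYPE('k::field) (path_edges x) c =
    {y. \<exists>f. covered c f \<and> (\<forall>k\<in>{1..n}. y $ x k = real (f k))}"
proof -
  let ?C = "\<lambda>k. c $ x k"
  have bounded: "b \<in> bounded_edge_sums (path_edges x) c q \<longleftrightarrow>
    (\<exists>w. feasible n ?C w \<and> (\<Sum>k<n. w k) = q \<and>
       (\<forall>k\<in>{1..n}. Poly_Mapping.lookup b (x k) = path_degree w k))" for b q
    by (auto simp: bounded_edge_sums_def edge_sums_path_iff feasible_def all_x_iff)
  have bounded_ne: "bounded_edge_sums (path_edges x) c q \<noteq> {} \<longleftrightarrow>
    (\<exists>w. feasible n ?C w \<and> (\<Sum>k<n. w k) = q)" for q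
  proof
    assume "\<exists>w. feasible n ?C w \<and> (\<Sum>k<n. w k) = q"
    then obtain w where "feasible n ?C w" "(\<Sum>k<n. w k) = q" by blast
    then have "of_labels (path_degree w) \<in> bounded_edge_sums (path_edges x) c q"
      unfolding bounded using lookup_of_labels by blast
    then show "bounded_edge_sums (path_edges x) c q \<noteq> {}" by blast
  qed (use bounded in blast)
  \<comment> \<open>A single unit on the first edge shows that the first power survives.\<close>
  have "feasible n ?C ((\<lambda>_. 0)(1 := 1))"
    using n_ge c by (auto simp: feasible_def path_degree_def Suc_le_eq)
  moreover have "(\<Sum>k<n. ((\<lambda>_. 0)(1 := 1)) k) = (1::nat)"
    using n_ge by (simp add: fun_upd_def)
  ultimately have "bounded_edge_sums (path_edges x) c 1 \<noteq> {}"
    using bounded_ne by blast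
  then obtain q where D: "D_vectors TYPE('k) (path_edges x) c =
       {\<chi> i. real (Poly_Mapping.lookup a i) | a. \<exists>b\<in>bounded_edge_sums (path_edges x) c q. \<exists>t. b = a + t}"
    and "bounded_edge_sums (path_edges x) c q \<noteq> {}"
    and "\<And>p. bounded_edge_sums (path_edges x) c p \<noteq> {} \<Longrightarrow> p \<le> q"
    by (rule D_vectors_eq[where 'k = 'k]) blast
  then obtain m where m: "feasible n ?C m" "(\<Sum>k<n. m k) = q"
    and max: "\<And>w. feasible n ?C w \<Longrightarrow> (\<Sum>k<n. w k) \<le> (\<Sum>k<n. m k)"
    unfolding bounded_ne by blast
  show ?thesis
    unfolding D
  proof (intro set_eqI iffI)
    fix y :: "real ^ 'n"
    assume "y \<in> {\<chi> i. real (Poly_Mapping.lookup a i) | a.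
      \<exists>b\<in>bounded_edge_sums (path_edges x) c q. \<exists>t. b = a + t}"
    then obtain a b t where y: "y = (\<chi> i. real (Poly_Mapping.lookup a i))"
      and b: "b \<in> bounded_edge_sums (path_edges x) c q" "b = a + t" by blast
    then obtain w where w: "feasible n ?C w"
      "\<forall>k\<in>{1..n}. Poly_Mapping.lookup b (x k) = path_degree w k" using bounded by blast
    have "Poly_Mapping.lookup a (x k) \<le> path_degree w k" if "k \<in> {1..n}" for k
      using w(2) b(2) that by (metis le_add1 lookup_add)
    then have "covered c (\<lambda>k. Poly_Mapping.lookup a (x k))"
      unfolding covered_def using w(1) by (intro exI[of _ w]) auto
    then show "y \<in> {y. \<exists>f. covered c f \<and> (\<forall>k\<in>{1..n}. y $ x k = real (f k))}"
      by (auto simp: y)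
  next
    fix y :: "real ^ 'n"
    assume "y \<in> {y. \<exists>f. covered c f \<and> (\<forall>k\<in>{1..n}. y $ x k = real (f k))}"
    then obtain f w1 w2 where y: "\<forall>k\<in>{1..n}. y $ x k = real (f k)"
      and w12: "feasible n ?C w1" "feasible n ?C w2"
      and f: "\<forall>k\<in>{1..n}. f k \<le> (if odd k then path_degree w1 k else path_degree w2 k)"
      by (auto simp: covered_def)
    obtain w where w: "feasible n ?C w" "(\<Sum>k<n. w k) = (\<Sum>k<n. m k)"
      "\<And>k. k \<in> {1..n} \<Longrightarrow> odd k \<Longrightarrow> path_degree w1 k \<le> path_degree w k"
      "\<And>k. k \<in> {1..n} \<Longrightarrow> even k \<Longrightarrow> path_degree w2 k \<le> path_degree w k"
      using maximum_feasible_exchange[OF m(1) max w12] by blast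
    have le: "f k \<le> path_degree w k" if "k \<in> {1..n}" for k
      using f w(3,4)[OF that] that by (cases "even k") force+
    have "of_labels (path_degree w) \<in> bounded_edge_sums (path_edges x) c q"
      unfolding bounded using w(1,2) m(2) lookup_of_labels by blast
    moreover have "of_labels (path_degree w) = of_labels f + of_labels (\<lambda>k. path_degree w k - f k)"
      by (rule poly_mapping_labels_eqI) (use le in \<open>auto simp: lookup_add lookup_of_labels\<close>)
    moreover have "y = (\<chi> i. real (Poly_Mapping.lookup (of_labels f) i))"
      by (simp add: vec_eq_iff all_x_iff y lookup_of_labels)
    ultimately show "y \<in> {\<chi> i. real (Poly_Mapping.lookup a i) | a.
      \<exists>b\<in>bounded_edge_sums (path_edges x) c q. \<exists>t. b = a + t}" by blast
  qed
qed

end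

section \<open>Reflexive polytopes\<close>

lemma dual_polytope_inner: "dual_polytope P = {x. \<forall>y\<in>P. x \<bullet> y \<le> 1}"
  by (simp add: dual_polytope_def inner_vec_def)

lemma Ints_inner: "(\<And>i. u $ i \<in> \<int>) \<Longrightarrow> (\<And>i. v $ i \<in> \<int>) \<Longrightarrow> u \<bullet> v \<in> \<int>" for u v :: "real ^ 'n"
  by (auto simp: inner_vec_def )

text \<open>The facet on which \<open>u \<bullet> y = b\<close> yields the vertex \<open>u / (d b - u \<bullet> a)\<close> of the dual, and
  \<open>u\<close> is primitive, so integrality of the vertex forces the denominator to be \<open>1\<close>.\<close>

lemma reflexive_facet:
  fixes u a :: "real ^ 'n" and d :: int
  assumes refl: "reflexive_polytope ((\<lambda>y. of_int d *\<^sub>R y - a) ` P)"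
    and d: "d > 0" and a: "\<And>i. a $ i \<in> \<int>"
    and u: "\<And>i. u $ i \<in> \<int>" "\<bar>u $ i0\<bar> = 1" and b: "b \<in> \<int>"
    and valid: "\<And>y. y \<in> P \<Longrightarrow> u \<bullet> y \<le> b"
    and F: "F \<subseteq> P" "F \<noteq> {}" "\<And>y. y \<in> F \<Longrightarrow> u \<bullet> y = b"
    and uniq: "\<And>z t. (\<And>y. y \<in> F \<Longrightarrow> z \<bullet> y = t) \<Longrightarrow> \<exists>s. z = s *\<^sub>R u"
  shows "of_int d * b - u \<bullet> a = 1"
proof -
  let ?Q = "(\<lambda>y. of_int d *\<^sub>R y - a) ` P"
  define \<beta> where "\<beta> = of_int d * b - u \<bullet> a"
  have u0: "u \<noteq> 0" using u(2) by auto
  have le: "u \<bullet> q \<le> \<beta>" if "q \<in> ?Q" for q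
    using that valid d by (auto simp: \<beta>_def inner_diff_right)
  have "0 \<in> interior ?Q" using refl by (simp add: reflexive_polytope_def)
  then obtain e where e: "e > 0" "cball 0 e \<subseteq> ?Q" by (auto simp: mem_interior_cball)
  have "(e / norm u) *\<^sub>R u \<in> cball 0 e" using e u0 by simp
  with e have "u \<bullet> ((e / norm u) *\<^sub>R u) \<le> \<beta>" using le by blast
  moreover have "u \<bullet> ((e / norm u) *\<^sub>R u) > 0" using e u0 by simp
  ultimately have pos: "\<beta> > 0" by linarith
  have dual: "dual_polytope ?Q = {z. \<forall>q\<in>?Q. z \<bullet> q \<le> 1}" by (rule dual_polytope_inner)
  let ?v = "(1 / \<beta>) *\<^sub>R u"
  have v: "?v \<in> dual_polytope ?Q" using le pos by (auto simp: dual field_simps)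
  \<comment> \<open>\<open>F\<close> spans the facet hyperplane, so a vector tight on all of it is a
    multiple of \<open>u\<close>, and the height fixes the factor.\<close>
  have eq: "z = ?v"
    if z: "\<And>y. y \<in> F \<Longrightarrow> z \<bullet> (of_int d *\<^sub>R y - a) = 1" for z
  proof -
    have "z \<bullet> y = (1 + z \<bullet> a) / of_int d" if "y \<in> F" for y
      using z[OF that] d by (simp add: inner_diff_right field_simps)
    then obtain s where s: "z = s *\<^sub>R u" using uniq by blast
    obtain y where y: "y \<in> F" using F(2) by blast
    have "s * \<beta> = 1" using z[OF y] by (simp add: s \<beta>_def algebra_simps F(3)[OF y])
    then have "s = 1 / \<beta>" using pos by (simp add: field_simps)
    with s show ?thesis by simp
  qed
  have "?v extreme_point_of dual_polytope ?Q"
    unfolding extreme_point_of_def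
  proof (intro conjI ballI v notI)
    fix p q assume pq: "p \<in> dual_polytope ?Q" "q \<in> dual_polytope ?Q" "?v \<in> open_segment p q"
    then obtain t where t: "0 < t" "t < 1" "?v = (1 - t) *\<^sub>R p + t *\<^sub>R q" and "p \<noteq> q"
      by (auto simp: in_segment)
    \<comment> \<open>A proper convex combination of two numbers at most \<open>1\<close> equals
      \<open>1\<close> only if both do.\<close>
    have "p \<bullet> (of_int d *\<^sub>R y - a) = 1 \<and> q \<bullet> (of_int d *\<^sub>R y - a) = 1" if y: "y \<in> F" for y
    proof -
      let ?g = "of_int d *\<^sub>R y - a"
      have 1: "p \<bullet> ?g \<le> 1" "q \<bullet> ?g \<le> 1" using pq F y by (auto simp: dual)
      have "u \<bullet> ?g = \<beta>" by (simp add: \<beta>_def inner_diff_right F(3)[OF y])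
      then have "?v \<bullet> ?g = 1" using pos by simp
      then have 2: "(1 - t) * (p \<bullet> ?g) + t * (q \<bullet> ?g) = 1"
        unfolding t(3) by (simp add: inner_add_left)
      have "(1 - t) * (1 - p \<bullet> ?g) \<ge> 0" "t * (1 - q \<bullet> ?g) \<ge> 0" using 1 t by simp_all
      moreover have "(1 - t) * (1 - p \<bullet> ?g) + t * (1 - q \<bullet> ?g) = 0"
        using 2 by (simp add: algebra_simps)
      ultimately have "(1 - t) * (1 - p \<bullet> ?g) = 0" "t * (1 - q \<bullet> ?g) = 0" by linarith+
      with t show ?thesis by simp
    qed
    then have "p = ?v" "q = ?v" by (auto intro!: eq)
    with \<open>p \<noteq> q\<close> show False by simp
  qed
  then have "?v $ i0 \<in> \<int>"
    using refl by (auto simp: reflexive_polytope_def lattice_polytope_def)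
  then have inv: "1 / \<beta> \<in> \<int>" using u(2) by (auto simp: abs_if split: if_splits)
  have "\<beta> \<in> \<int>" unfolding \<beta>_def using b Ints_inner[OF u(1) a] by simp
  with inv pos obtain k m :: int where "\<beta> = of_int k" "1 / \<beta> = of_int m"
    by (auto elim!: Ints_cases)
  then have "of_int (k * m) = (1 :: real)" "k > 0" using pos by (auto simp: field_simps)
  then have "k * m = 1" by linarith
  then have "k = 1" using \<open>k > 0\<close> by (simp add: zmult_eq_1_iff)
  with \<open>\<beta> = of_int k\<close> show ?thesis by (simp add: \<beta>_def)
qed

lemma lattice_polytope_convex_hull:
  assumes "finite S" "\<And>y i. y \<in> S \<Longrightarrow> y $ i \<in> \<int>"
  shows "lattice_polytope (convex hull S)"
  using assms extreme_point_of_convex_hull[of _ S]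
  by (auto simp: lattice_polytope_def polytope_def)

text \<open>The bipolar theorem. A functional separating \<open>z\<close> from the hull has a
  negative bound, because the hull contains the origin; dividing by the bound gives a point of the
  polyhedron on which \<open>z\<close> exceeds \<open>1\<close>.\<close>

lemma dual_polytope_halfspaces:
  fixes U :: "(real ^ 'n) set"
  assumes "finite U" "0 \<in> convex hull U"
  shows "dual_polytope {y. \<forall>u\<in>U. u \<bullet> y \<le> 1} = convex hull U"
proof
  let ?P = "{y. \<forall>u\<in>U. u \<bullet> y \<le> 1}"
  have "U \<subseteq> dual_polytope ?P" by (auto simp: dual_polytope_inner)
  moreover have "convex (dual_polytope ?P)"
    unfolding dual_polytope_inner convex_def
    by (auto simp: inner_add_left intro!: convex_bound_le)
  ultimately show "convex hull U \<subseteq> dual_polytope ?P" by (rule hull_minimal)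
  show "dual_polytope ?P \<subseteq> convex hull U"
  proof (rule ccontr)
    assume "\<not> dual_polytope ?P \<subseteq> convex hull U"
    then obtain z where z: "z \<in> dual_polytope ?P" "z \<notin> convex hull U" by blast
    have "closed (convex hull U)"
      using assms(1) by (simp add: compact_imp_closed finite_imp_compact_convex_hull)
    then obtain w b where w: "w \<bullet> z < b" "\<forall>u\<in>convex hull U. w \<bullet> u > b"
      using separating_hyperplane_closed_point[OF convex_convex_hull _ z(2)] by blast
    then have b: "b < 0" using assms(2) by force
    have "u \<bullet> ((1 / b) *\<^sub>R w) \<le> 1" if "u \<in> U" for u
    proof -
      have "b < w \<bullet> u" using w(2) that by (simp add: hull_inc)
      then show ?thesis using b by (simp add: divide_le_eq inner_commute)
    qed
    then have "(1 / b) *\<^sub>R w \<in> ?P" by blast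
    then have "z \<bullet> ((1 / b) *\<^sub>R w) \<le> 1" using z(1) unfolding dual_polytope_inner by blast
    then show False using w(1) b by (simp add: divide_le_eq inner_commute)
  qed
qed

text \<open>The condition on \<open>b\<close> puts all bounding hyperplanes at height
  \<open>1\<close> after dilation and translation, so the dual is the hull of the integral normals
  \<open>U\<close>.\<close>

lemma gorenstein_polytopeI:
  fixes U :: "(real ^ 'n) set" and d :: int
  assumes S: "finite S" "\<And>y i. y \<in> S \<Longrightarrow> y $ i \<in> \<int>" "P = convex hull S"
    and U: "finite U" "\<And>u i. u \<in> U \<Longrightarrow> u $ i \<in> \<int>" "0 \<in> convex hull U"
    and P: "P = {y. \<forall>u\<in>U. u \<bullet> y \<le> b u}"
    and d: "d > 0" and a: "\<And>i. a $ i \<in> \<int>" and b: "\<And>u. u \<in> U \<Longrightarrow> of_int d * b u = 1 + u \<bullet> a"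
  shows "gorenstein_polytope P"
proof -
  let ?f = "\<lambda>y. of_int d *\<^sub>R y - a"
  have Q: "?f ` P = {y. \<forall>u\<in>U. u \<bullet> y \<le> 1}"
  proof (intro set_eqI iffI)
    fix q assume "q \<in> ?f ` P"
    then obtain y where y: "\<forall>u\<in>U. u \<bullet> y \<le> b u" "q = ?f y" by (auto simp: P)
    have "u \<bullet> q \<le> 1" if "u \<in> U" for u
    proof -
      have "of_int d * (u \<bullet> y) \<le> of_int d * b u" using y that d by simp
      then show ?thesis using b[OF that] by (simp add: y(2) inner_diff_right)
    qed
    then show "q \<in> {y. \<forall>u\<in>U. u \<bullet> y \<le> 1}" by simp
  next
    fix q assume q: "q \<in> {y. \<forall>u\<in>U. u \<bullet> y \<le> 1}"
    let ?y = "(1 / of_int d) *\<^sub>R (q + a)"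
    have "u \<bullet> ?y \<le> b u" if "u \<in> U" for u
    proof -
      have "u \<bullet> q \<le> 1" using q that by simp
      then have "u \<bullet> (q + a) \<le> of_int d * b u" using b[OF that] by (simp add: inner_add_right)
      then show ?thesis using d by (simp add: divide_le_eq mult.commute)
    qed
    then have "?y \<in> P" by (simp add: P)
    moreover have "q = ?f ?y" using d by simp
    ultimately show "q \<in> ?f ` P" by blast
  qed
  have open_half: "open (\<Inter>u\<in>U. {y. u \<bullet> y < r u})" for r
    using U(1) by (intro open_INT) (auto intro: open_halfspace_lt)
  \<comment> \<open>The preimage of the origin has slack \<open>1 / d\<close> in every
    inequality.\<close>
  have "(1 / of_int d) *\<^sub>R a \<in> interior P"
  proof (rule interiorI[OF open_half])
    have "u \<bullet> a < of_int d * b u" if "u \<in> U" for u using b[OF that] by simp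
    then show "(1 / of_int d) *\<^sub>R a \<in> (\<Inter>u\<in>U. {y. u \<bullet> y < b u})"
      using d by (auto simp: divide_less_eq mult.commute)
  qed (auto simp: P intro: less_imp_le)
  then have dim: "aff_dim P = int CARD('n)"
    using aff_dim_nonempty_interior[of P] by auto
  have int0: "0 \<in> interior (?f ` P)"
    by (rule interiorI[OF open_half[of "\<lambda>_. 1"]]) (auto simp: Q intro: less_imp_le)
  then have dimQ: "aff_dim (?f ` P) = int CARD('n)"
    using aff_dim_nonempty_interior[of "?f ` P"] by auto
  have "?f ` P = (\<lambda>z. - a + z) ` ((\<lambda>y. of_int d *\<^sub>R y) ` (convex hull S))"
    by (simp add: image_image S(3))
  also have "\<dots> = convex hull ((\<lambda>z. - a + z) ` ((\<lambda>y. of_int d *\<^sub>R y) ` S))"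
    by (simp only: convex_hull_scaling[symmetric] convex_hull_translation)
  finally have "?f ` P = convex hull ((\<lambda>z. - a + z) ` ((\<lambda>y. of_int d *\<^sub>R y) ` S))" .
  then have "lattice_polytope (?f ` P)"
    using S(1,2) a by (auto intro!: lattice_polytope_convex_hull)
  moreover have "lattice_polytope (dual_polytope (?f ` P))"
    unfolding Q dual_polytope_halfspaces[OF U(1,3)] using U by (intro lattice_polytope_convex_hull)
  ultimately have "reflexive_polytope (?f ` P)"
    unfolding reflexive_polytope_def using dimQ int0 by blast
  moreover have "lattice_polytope P"
    unfolding S(3) using S by (intro lattice_polytope_convex_hull)
  ultimately show ?thesis unfolding gorenstein_polytope_def using dim d a by blast
qed

section \<open>Integrality of boxes cut by one sum constraint\<close>

text \<open>One shape for all polytopes of the classification: for \<open>T = {}\<close> and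
  \<open>h = 0\<close> the sum constraint is vacuous and a box remains.\<close>

definition truncated_box :: "('n \<Rightarrow> real) \<Rightarrow> 'n set \<Rightarrow> real \<Rightarrow> (real ^ 'n) set" where
  "truncated_box C T h = {y. (\<forall>i. 0 \<le> y $ i \<and> y $ i \<le> C i) \<and> (\<Sum>i\<in>T. y $ i) \<le> h}"

lemma finite_integral_box: "finite {y :: real ^ 'n. \<forall>i. 0 \<le> y $ i \<and> y $ i \<le> C i \<and> y $ i \<in> \<int>}"
proof (rule finite_subset)
  let ?A = "\<lambda>i. {r. 0 \<le> r \<and> r \<le> C i \<and> r \<in> \<int>}"
  show "{y :: real ^ 'n. \<forall>i. 0 \<le> y $ i \<and> y $ i \<le> C i \<and> y $ i \<in> \<int>} \<subseteq> vec_lambda ` (\<Pi>\<^sub>E i\<in>UNIV. ?A i)"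
  proof
    fix y :: "real ^ 'n" assume "y \<in> {y. \<forall>i. 0 \<le> y $ i \<and> y $ i \<le> C i \<and> y $ i \<in> \<int>}"
    then have "($) y \<in> (\<Pi>\<^sub>E i\<in>UNIV. ?A i)" by auto
    then show "y \<in> vec_lambda ` (\<Pi>\<^sub>E i\<in>UNIV. ?A i)"
      by (intro image_eqI[of _ _ "($) y"]) (simp_all only: vec_nth_inverse)
  qed
  have "finite (?A i)" for i
    by (rule finite_subset[OF _ finite_abs_int_segment[of "\<bar>C i\<bar>"]]) auto
  then show "finite (vec_lambda ` (\<Pi>\<^sub>E i\<in>UNIV. ?A i))" by (intro finite_imageI finite_PiE) auto
qed

lemma not_extreme_pointI:
  assumes "y + w \<in> P" "y - w \<in> P" "w \<noteq> 0"
  shows "\<not> y extreme_point_of P"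
proof -
  have "y - w \<noteq> y + w"
  proof
    assume "y - w = y + w"
    then have "2 *\<^sub>R w = 0" unfolding scaleR_2 by (simp add: algebra_simps)
    with assms(3) show False by simp
  qed
  moreover have "midpoint (y - w) (y + w) = y"
    by (simp add: midpoint_def flip: scaleR_2)
  ultimately have "y \<in> open_segment (y - w) (y + w)" by (metis midpoint_in_open_segment)
  with assms(1,2) show ?thesis by (auto simp: extreme_point_of_def)
qed

text \<open>Extreme points are integral: a fractional coordinate can be moved both ways alone if the
  sum constraint does not react, and otherwise against a second fractional coordinate in
  \<open>T\<close>. Krein-Milman concludes.\<close>

lemma truncated_box_integral:
  fixes C :: "'n::finite \<Rightarrow> real"
  assumes C: "\<And>i. C i \<in> \<int>" and h: "h \<in> \<int>"
  shows "truncated_box C T h = convex hull {y \<in> truncated_box C T h. \<forall>i. y $ i \<in> \<int>}"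
proof -
  let ?P = "truncated_box C T h"
  have "closed ?P"
    unfolding truncated_box_def
    by (intro closed_Collect_conj closed_Collect_all closed_Collect_le continuous_intros)
  moreover have "bounded ?P"
    by (rule bounded_subset[OF bounded_cbox[of 0 "\<chi> i. C i"]])
      (auto simp: truncated_box_def mem_box_cart)
  moreover have "convex ?P"
    by (auto simp: truncated_box_def convex_def sum.distrib sum_distrib_left[symmetric]
        intro!: convex_bound_le)
  ultimately have KM: "?P = convex hull {y. y extreme_point_of ?P}"
    by (intro Krein_Milman_Minkowski) (auto simp: compact_eq_bounded_closed)
  have "y $ i \<in> \<int>" if ext: "y extreme_point_of ?P" for y i
  proof (rule ccontr)
    assume i: "y $ i \<notin> \<int>"
    have y: "\<And>i. 0 \<le> y $ i" "\<And>i. y $ i \<le> C i" "(\<Sum>i\<in>T. y $ i) \<le> h"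
      using ext by (auto simp: extreme_point_of_def truncated_box_def)
    have frac: "0 < y $ j \<and> y $ j < C j" if "y $ j \<notin> \<int>" for j
      using that y(1,2)[of j] C[of j] by (metis Ints_0 order_le_less)
    show False
    proof (cases "i \<in> T \<and> (\<Sum>i\<in>T. y $ i) = h")
      case False
      \<comment> \<open>The least slack among the constraints that move; outside \<open>T\<close>
        the sum is unaffected, and \<open>1\<close> is a neutral value.\<close>
      define e where "e = min (min (y $ i) (C i - y $ i)) (if i \<in> T then h - (\<Sum>i\<in>T. y $ i) else 1)"
      have e: "e > 0" using frac[OF i] False y(3) by (auto simp: e_def)
      have "(\<Sum>j\<in>T. axis i e $ j) = (if i \<in> T then e else 0)" by (simp add: axis_def)
      then have "y + axis i e \<in> ?P" "y - axis i e \<in> ?P"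
        using y e by (auto simp: truncated_box_def sum.distrib sum_subtractf axis_def e_def)
      then show False using not_extreme_pointI ext e by (metis axis_eq_0_iff less_irrefl)
    next
      case True
      \<comment> \<open>The sum is the integer \<open>h\<close>, so it cannot have exactly one
        fractional summand.\<close>
      have "\<exists>j\<in>T - {i}. y $ j \<notin> \<int>"
      proof (rule ccontr)
        assume "\<not> ?thesis"
        then have "(\<Sum>j\<in>T - {i}. y $ j) \<in> \<int>" by auto
        moreover have "y $ i = h - (\<Sum>j\<in>T - {i}. y $ j)"
          using True sum.remove[of T i "($) y"] by auto
        ultimately show False using i h by auto
      qed
      then obtain j where j: "j \<in> T" "j \<noteq> i" "y $ j \<notin> \<int>" by blast
      define e where "e = min (min (y $ i) (C i - y $ i)) (min (y $ j) (C j - y $ j))"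
      have e: "e > 0" using frac[OF i] frac[OF j(3)] by (auto simp: e_def)
      define w where "w = axis i e - axis j e"
      have "(\<Sum>k\<in>T. w $ k) = 0" using True j by (simp add: w_def axis_def sum_subtractf)
      moreover have wk: "w $ k = (if k = i then e else if k = j then - e else 0)" for k
        using j by (auto simp: w_def axis_def)
      ultimately have "y + w \<in> ?P" "y - w \<in> ?P"
        using y e by (auto simp: truncated_box_def sum.distrib sum_subtractf e_def)
      moreover have "w \<noteq> 0" using e wk[of i] by auto
      ultimately show False using not_extreme_pointI ext by blast
    qed
  qed
  then have "{y. y extreme_point_of ?P} \<subseteq> {y \<in> ?P. \<forall>i. y $ i \<in> \<int>}"
    by (auto simp: extreme_point_of_def)
  from ord_eq_le_trans[OF KM hull_mono[OF this]]
  have "?P \<subseteq> convex hull {y \<in> ?P. \<forall>i. y $ i \<in> \<int>}" .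
  moreover have "convex hull {y \<in> ?P. \<forall>i. y $ i \<in> \<int>} \<subseteq> ?P"
    using \<open>convex ?P\<close> by (intro hull_minimal) auto
  ultimately show ?thesis by blast
qed

section \<open>Facets of the path polytope\<close>

context path_labelling
begin

definition labelled :: "(nat \<Rightarrow> real) \<Rightarrow> real ^ 'n" where
  "labelled f = (\<chi> i. f (inv_into {1..n} x i))"

lemma labelled_nth: "k \<in> {1..n} \<Longrightarrow> labelled f $ x k = f k"
  unfolding labelled_def using bij_x by (simp add: bij_betw_def)

lemma labelled_eqI: "(\<And>k. k \<in> {1..n} \<Longrightarrow> y $ x k = f k) \<Longrightarrow> y = labelled f"
  unfolding vec_eq_iff by (subst all_x_iff) (metis labelled_nth)

lemma inner_labels: "z \<bullet> y = (\<Sum>k\<in>{1..n}. z $ x k * y $ x k)" for z y :: "real ^ 'n"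
  unfolding inner_vec_def by (simp add: sum.reindex_bij_betw[OF bij_x, symmetric])

text \<open>The choice of \<open>real\<close> is arbitrary: \<open>D_vectors_covered\<close> gives
  the same vectors for every field.\<close>

abbreviation path_polytope :: "nat ^ 'n \<Rightarrow> (real ^ 'n) set" where
  "path_polytope c \<equiv> convex hull (D_vectors TYPE(real) (path_edges x) c)"

text \<open>Capacity \<open>0\<close> outside the path makes the end vertices behave like the others.\<close>

definition capacity :: "nat ^ 'n \<Rightarrow> nat \<Rightarrow> nat" where
  "capacity c k = (if k \<in> {1..n} then c $ x k else 0)"

lemma feasible_capacity: "feasible n (\<lambda>k. c $ x k) w \<longleftrightarrow> feasible n (capacity c) w"
  by (auto simp: feasible_def capacity_def)

lemma coveredI:
  assumes "feasible n (capacity c) w1" "feasible n (capacity c) w2"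
    and "\<And>k. k \<in> {1..n} \<Longrightarrow> odd k \<Longrightarrow> f k \<le> path_degree w1 k"
    and "\<And>k. k \<in> {1..n} \<Longrightarrow> even k \<Longrightarrow> f k \<le> path_degree w2 k"
  shows "covered c f"
  unfolding covered_def feasible_capacity
  using assms by (intro exI[of _ w1] exI[of _ w2]) simp

lemma coveredE:
  assumes "covered c f"
  obtains w1 w2 where "feasible n (capacity c) w1" "feasible n (capacity c) w2"
    "\<And>k. k \<in> {1..n} \<Longrightarrow> odd k \<Longrightarrow> f k \<le> path_degree w1 k"
    "\<And>k. k \<in> {1..n} \<Longrightarrow> even k \<Longrightarrow> f k \<le> path_degree w2 k"
proof -
  obtain w1 w2 where "feasible n (capacity c) w1" "feasible n (capacity c) w2"
    and *: "\<forall>k\<in>{1..n}. f k \<le> (if odd k then path_degree w1 k else path_degree w2 k)"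
    using assms unfolding covered_def feasible_capacity by blast
  then show thesis by (intro that[of w1 w2]) (use * in force)+
qed

lemma covered_mono: "covered c g \<Longrightarrow> (\<And>k. k \<in> {1..n} \<Longrightarrow> f k \<le> g k) \<Longrightarrow> covered c f"
  unfolding covered_def by (meson order_trans)

lemma covered_combine:
  assumes "covered c f" "covered c g"
  shows "covered c (\<lambda>k. if odd k then f k else g k)"
proof -
  obtain w1 w2 where "feasible n (capacity c) w1"
    "\<And>k. k \<in> {1..n} \<Longrightarrow> odd k \<Longrightarrow> f k \<le> path_degree w1 k"
    "feasible n (capacity c) w2" "\<And>k. k \<in> {1..n} \<Longrightarrow> even k \<Longrightarrow> g k \<le> path_degree w2 k"
    using assms by (metis coveredE)
  then show ?thesis by (intro coveredI[of c w1 w2]) simp_all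
qed

lemma feasible_le_capacity:
  assumes w: "feasible n (capacity c) w" and i: "i \<in> {1..n}"
  shows "w (i - 1) \<le> capacity c (i - 1)" "w i \<le> capacity c (i + 1)"
proof -
  show "w (i - 1) \<le> capacity c (i - 1)"
  proof (cases "i = 1")
    case False
    with i have "i - 1 \<in> {1..n}" by auto
    then have "path_degree w (i - 1) \<le> capacity c (i - 1)" using w unfolding feasible_def by blast
    then show ?thesis by (simp add: path_degree_def)
  qed (use w in \<open>simp add: feasible_def\<close>)
  show "w i \<le> capacity c (i + 1)"
  proof (cases "i = n")
    case False
    with i have "i + 1 \<in> {1..n}" by auto
    then have "path_degree w (i + 1) \<le> capacity c (i + 1)" using w unfolding feasible_def by blast
    then show ?thesis by (simp add: path_degree_def)
  qed (use w in \<open>simp add: feasible_def\<close>)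
qed

text \<open>The maximum degree at \<open>i\<close> over all feasible weightings: the edges at
  \<open>i\<close> are limited by \<open>i\<close> itself and by its neighbours. See
  \<open>covered_le_star_capacity\<close> and \<open>covered_star\<close>.\<close>

definition star_capacity :: "nat ^ 'n \<Rightarrow> nat \<Rightarrow> nat" where
  "star_capacity c i = min (capacity c i) (capacity c (i - 1) + capacity c (i + 1))"

lemma covered_le_star_capacity:
  assumes "covered c f" "i \<in> {1..n}"
  shows "f i \<le> star_capacity c i"
proof -
  have "\<exists>w. feasible n (capacity c) w \<and> f i \<le> path_degree w i"
    using assms by (elim coveredE, cases "odd i") auto
  then obtain w where w: "feasible n (capacity c) w" "f i \<le> path_degree w i" by blast
  then have "path_degree w i \<le> capacity c i" using assms(2) by (simp add: feasible_def)
  with w feasible_le_capacity[OF w(1) assms(2)] show ?thesis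
    by (simp add: star_capacity_def path_degree_def)
qed

end

section \<open>Coverings by a star and one further edge\<close>

locale capacitated_path = path_labelling n x
  for n and x :: "nat \<Rightarrow> 'n::finite" +
  fixes c :: "nat ^ 'n"
  assumes c_pos: "\<And>i. c $ i > 0"
begin

lemma capacity_pos: "k \<in> {1..n} \<Longrightarrow> capacity c k > 0"
  by (simp add: capacity_def c_pos)

lemma capacity_outside [simp]: "capacity c 0 = 0" "capacity c (Suc n) = 0"
  by (simp_all add: capacity_def)

lemma D_vectors_covered:
  "D_vectors TYPE('k::field) (path_edges x) c = {labelled (\<lambda>k. real (f k)) | f. covered c f}"
proof -
  have "(\<forall>k\<in>{1..n}. y $ x k = real (f k)) \<longleftrightarrow> y = labelled (\<lambda>k. real (f k))" for y f
    using labelled_eqI labelled_nth by metis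
  then show ?thesis unfolding D_vectors_path[OF c_pos] by blast
qed

text \<open>A star at \<open>i\<close> with weights \<open>\<alpha>\<close> to the left and
  \<open>\<beta>\<close> to the right, plus a unit on an edge \<open>m\<close> off \<open>i\<close>.
  The two can only collide at a neighbour of \<open>i\<close>, namely for \<open>m = i + 1\<close>
  or \<open>m + 2 = i\<close>; away from the star all degrees are at most \<open>1\<close>.\<close>

lemma feasible_star_edge:
  assumes "i \<in> {1..n}" "\<alpha> + \<beta> \<le> capacity c i" "\<alpha> \<le> capacity c (i - 1)" "\<beta> \<le> capacity c (i + 1)"
    and "m \<in> {1..<n}" "m \<noteq> i" "m + 1 \<noteq> i"
    and "m = i + 1 \<Longrightarrow> \<beta> < capacity c (i + 1)" "m + 2 = i \<Longrightarrow> \<alpha> < capacity c (i - 1)"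
  shows "feasible n (capacity c) ((\<lambda>_. 0)(i - 1 := \<alpha>, i := \<beta>, m := 1))"
proof -
  let ?w = "(\<lambda>_. 0)(i - 1 := \<alpha>, i := \<beta>, m := 1)"
  have "?w 0 = 0" using assms(1,3,5) by (cases "i = 1") auto
  moreover have "?w n = 0" using assms(1,4,5) by (cases "i = n") auto
  moreover have "path_degree ?w k \<le> capacity c k" if k: "k \<in> {1..n}" for k
  proof -
    consider "k = i" | "k + 1 = i" | "k = i + 1" | "k < i - 1" | "k > i + 1"
      using k by fastforce
    then show ?thesis
    proof cases
      case 1
      then show ?thesis using assms by (auto simp: path_degree_def)
    next
      case 2
      then have "path_degree ?w k = \<alpha> + (if m + 2 = i then 1 else 0)"
        using assms(1,5-7) k by (auto simp: path_degree_def)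
      then show ?thesis using assms(3,9) 2 by (auto split: if_splits)
    next
      case 3
      then have "path_degree ?w k = \<beta> + (if m = i + 1 then 1 else 0)"
        using assms(1,5-7) k by (auto simp: path_degree_def)
      then show ?thesis using assms(4,8) 3 by (auto split: if_splits)
    next
      case 4
      then have "path_degree ?w k \<le> 1" using k by (auto simp: path_degree_def)
      then show ?thesis using capacity_pos[OF k] by linarith
    next
      case 5
      then have "path_degree ?w k \<le> 1" using k by (auto simp: path_degree_def)
      then show ?thesis using capacity_pos[OF k] by linarith
    qed
  qed
  ultimately show ?thesis unfolding feasible_def by blast
qed

lemma path_degree_star_edge:
  assumes "i \<in> {1..n}" "m \<noteq> i" "m + 1 \<noteq> i"
  shows "path_degree ((\<lambda>_. 0)(i - 1 := \<alpha>, i := \<beta>, m := 1)) i = \<alpha> + \<beta>"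
    and "m \<ge> 1 \<Longrightarrow> path_degree ((\<lambda>_. 0)(i - 1 := \<alpha>, i := \<beta>, m := 1)) m \<ge> 1"
    and "path_degree ((\<lambda>_. 0)(i - 1 := \<alpha>, i := \<beta>, m := 1)) (m + 1) \<ge> 1"
  using assms by (auto simp: path_degree_def)

lemma feasible_edge: "m \<in> {1..<n} \<Longrightarrow> feasible n (capacity c) ((\<lambda>_. 0)(m := 1))"
  using capacity_pos by (auto simp: feasible_def path_degree_def Suc_le_eq)

lemma feasible_zero: "feasible n (capacity c) (\<lambda>_. 0)"
  by (simp add: feasible_def path_degree_def)

lemma covered_zero: "covered c (\<lambda>_. 0)"
  using feasible_zero feasible_zero by (rule coveredI) auto

lemma covered_unit:
  assumes j: "j \<in> {1..n}"
  shows "covered c ((\<lambda>_. 0)(j := 1))"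
proof -
  define m where "m = (if j < n then j else j - 1)"
  have "m \<in> {1..<n}" using j n_ge by (auto simp: m_def)
  then have w: "feasible n (capacity c) ((\<lambda>_. 0)(m := 1))" by (rule feasible_edge)
  show ?thesis using w w by (rule coveredI) (use j n_ge in \<open>auto simp: m_def path_degree_def\<close>)
qed

text \<open>A unit in the colour class opposite to \<open>i\<close> is free, since that class has
  its own weighting.\<close>

lemma covered_add_unit:
  assumes g: "covered c g" "\<And>k. k \<in> {1..n} \<Longrightarrow> even k \<noteq> even i \<Longrightarrow> g k = 0"
    and j: "j \<in> {1..n}" "even j \<noteq> even i"
  shows "covered c (g(j := 1))"
proof (cases "odd j")
  case True
  with j have "even i" by auto
  have "covered c (\<lambda>k. if odd k then ((\<lambda>_. 0)(j := 1)) k else g k)"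
    by (rule covered_combine[OF covered_unit[OF j(1)] g(1)])
  then show ?thesis
    by (rule covered_mono) (use True \<open>even i\<close> g(2) in auto)
next
  case False
  with j have "odd i" by auto
  have "covered c (\<lambda>k. if odd k then g k else ((\<lambda>_. 0)(j := 1)) k)"
    by (rule covered_combine[OF g(1) covered_unit[OF j(1)]])
  then show ?thesis
    by (rule covered_mono) (use False \<open>odd i\<close> g(2) in auto)
qed

lemma covered_star_edge:
  assumes "i \<in> {1..n}" "\<alpha> + \<beta> \<le> capacity c i" "\<alpha> \<le> capacity c (i - 1)" "\<beta> \<le> capacity c (i + 1)"
    and "m \<in> {1..<n}" "m \<noteq> i" "m + 1 \<noteq> i"
    and "m = i + 1 \<Longrightarrow> \<beta> < capacity c (i + 1)" "m + 2 = i \<Longrightarrow> \<alpha> < capacity c (i - 1)"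
    and "j = m \<or> j = m + 1" "even j = even i"
  shows "covered c ((\<lambda>_. 0)(i := \<alpha> + \<beta>, j := 1))"
proof -
  let ?w = "(\<lambda>_. 0)(i - 1 := \<alpha>, i := \<beta>, m := 1)"
  have w: "feasible n (capacity c) ?w" using assms(1-9) by (rule feasible_star_edge)
  have "path_degree ?w i = \<alpha> + \<beta>" "path_degree ?w j \<ge> 1"
    using path_degree_star_edge[OF assms(1,6,7)] assms(5,10) by auto
  with assms(6,7,10) show ?thesis by (intro coveredI[OF w w]) (auto simp: fun_upd_def)
qed

lemma covered_star:
  assumes i: "i \<in> {1..n}"
  shows "covered c ((\<lambda>_. 0)(i := star_capacity c i))"
proof -
  define \<alpha> where "\<alpha> = min (capacity c (i - 1)) (capacity c i)"
  define \<beta> where "\<beta> = star_capacity c i - \<alpha>"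
  have ab: "\<alpha> + \<beta> = star_capacity c i" "\<alpha> \<le> capacity c (i - 1)" "\<beta> \<le> capacity c (i + 1)"
    by (auto simp: \<alpha>_def \<beta>_def star_capacity_def)
  let ?w = "(\<lambda>_. 0)(i - 1 := \<alpha>, i := \<beta>)"
  have deg: "path_degree ?w k = (if k = i then star_capacity c i else if k + 1 = i then \<alpha>
      else if k = i + 1 then \<beta> else 0)" if "k \<in> {1..n}" for k
    using that i ab(1) by (auto simp: path_degree_def)
  \<comment> \<open>At the ends, the missing neighbour has capacity \<open>0\<close>, which forces
    the phantom edge to weight \<open>0\<close>.\<close>
  have "?w 0 = 0" using i ab(2) by (cases "i = 1") auto
  moreover have "?w n = 0" using i ab(3) by (cases "i = n") auto
  moreover have "path_degree ?w k \<le> capacity c k" if k: "k \<in> {1..n}" for k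
    unfolding deg[OF k] using ab by (auto simp: star_capacity_def)
  ultimately have w: "feasible n (capacity c) ?w" unfolding feasible_def by blast
  show ?thesis by (rule coveredI[OF w w]) (use deg in auto)
qed

text \<open>A unit at \<open>j\<close> is placed on an edge leading away from \<open>i\<close>. Only
  an end vertex at distance two from \<open>i\<close> lacks such an edge; its unit must pass through
  a neighbour of \<open>i\<close>, which is possible if the neighbours have capacity to
  spare.\<close>

lemma covered_star_unit:
  assumes i: "i \<in> {1..n}" and j: "j \<in> {1..n}" "j \<noteq> i"
    and cond: "i + 2 \<noteq> n \<and> i \<noteq> 3 \<or> capacity c i < capacity c (i - 1) + capacity c (i + 1)"
  shows "covered c ((\<lambda>_. 0)(i := star_capacity c i, j := 1))"
proof -
  let ?r = "star_capacity c i"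
  have same: "covered c ((\<lambda>_. 0)(i := ?r, j := 1))"
    if j: "j \<in> {1..n}" "j \<noteq> i" "even j = even i" for j
  proof (cases "i < j")
    case True
    with j have ij: "i + 2 \<le> j" by (metis Suc_leI add_2_eq_Suc' even_Suc le_neq_implies_less)
    define m where "m = (if j < n then j else n - 1)"
    \<comment> \<open>The left edge is loaded as much as possible, so that any spare capacity is
      found at the right neighbour, where the unit may be needed. The case \<open>j < i\<close>
      mirrors this.\<close>
    define \<alpha> where "\<alpha> = min (capacity c (i - 1)) (capacity c i)"
    define \<beta> where "\<beta> = ?r - \<alpha>"
    have \<beta>: "\<alpha> + \<beta> = ?r" "\<beta> \<le> capacity c (i + 1)"
      by (auto simp: \<alpha>_def \<beta>_def star_capacity_def)
    have m1: "\<beta> < capacity c (i + 1)" if "m = i + 1"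
    proof -
      have "n = i + 2" using that ij j(1) by (auto simp: m_def split: if_splits)
      with cond have *: "capacity c i < capacity c (i - 1) + capacity c (i + 1)" by simp
      have "capacity c (i + 1) > 0" using \<open>n = i + 2\<close> by (intro capacity_pos) auto
      with * show ?thesis by (auto simp: \<alpha>_def \<beta>_def star_capacity_def)
    qed
    have "covered c ((\<lambda>_. 0)(i := \<alpha> + \<beta>, j := 1))"
    proof (rule covered_star_edge[OF i])
      show "\<alpha> + \<beta> \<le> capacity c i" unfolding \<beta> by (simp add: star_capacity_def)
      show "m = i + 1 \<Longrightarrow> \<beta> < capacity c (i + 1)" by (rule m1)
    qed (use \<beta> ij i j in \<open>auto simp: \<alpha>_def m_def\<close>)
    then show ?thesis by (simp add: \<beta>)
  next
    case False
    with j have "j < i" by simp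
    with j have ij: "j + 2 \<le> i" by (metis Suc_leI add_2_eq_Suc' even_Suc le_neq_implies_less)
    define m where "m = (if 1 < j then j - 1 else 1)"
    define \<beta> where "\<beta> = min (capacity c (i + 1)) (capacity c i)"
    define \<alpha> where "\<alpha> = ?r - \<beta>"
    have \<alpha>: "\<alpha> + \<beta> = ?r" "\<alpha> \<le> capacity c (i - 1)"
      by (auto simp: \<alpha>_def \<beta>_def star_capacity_def)
    have m1: "\<alpha> < capacity c (i - 1)" if "m + 2 = i"
    proof -
      have "i = 3" using that ij j(1) by (auto simp: m_def split: if_splits)
      with cond have *: "capacity c i < capacity c (i - 1) + capacity c (i + 1)" by simp
      have "capacity c (i - 1) > 0" using \<open>i = 3\<close> i by (intro capacity_pos) auto
      with * show ?thesis by (auto simp: \<alpha>_def \<beta>_def star_capacity_def)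
    qed
    have "covered c ((\<lambda>_. 0)(i := \<alpha> + \<beta>, j := 1))"
    proof (rule covered_star_edge[OF i])
      show "\<alpha> + \<beta> \<le> capacity c i" unfolding \<alpha> by (simp add: star_capacity_def)
      show "m + 2 = i \<Longrightarrow> \<alpha> < capacity c (i - 1)" by (rule m1)
    qed (use \<alpha> ij i j in \<open>auto simp: \<beta>_def m_def split: if_splits\<close>)
    then show ?thesis by (simp add: \<alpha>)
  qed
  show ?thesis
  proof (cases "even j = even i")
    case False
    have "covered c ((\<lambda>_. 0)(i := ?r))" by (rule covered_star[OF i])
    then show ?thesis by (rule covered_add_unit[of _ i]) (use False j in auto)
  qed (use same j in blast)
qed

end

section \<open>Facet equations and the capacities they force\<close>

locale gorenstein_path = capacitated_path n x c
  for n and x :: "nat \<Rightarrow> 'n::finite" and c +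
  fixes d :: int and a :: "real ^ 'n"
  assumes d_pos: "d > 0" and a_int: "\<And>i. a $ i \<in> \<int>"
    and reflexive: "reflexive_polytope ((\<lambda>y. of_int d *\<^sub>R y - a) ` path_polytope c)"
begin

text \<open>\<open>reflexive_facet\<close> in path coordinates. Validity need only be checked on
  covered vectors, as the polytope is their hull; the last hypothesis says that \<open>F\<close>
  spans the facet hyperplane.\<close>

lemma facet_equation:
  fixes u :: "nat \<Rightarrow> real"
  assumes u: "\<And>k. k \<in> {1..n} \<Longrightarrow> u k \<in> \<int>" "j \<in> {1..n}" "\<bar>u j\<bar> = 1" and b: "b \<in> \<int>"
    and valid: "\<And>f. covered c f \<Longrightarrow> (\<Sum>k\<in>{1..n}. u k * real (f k)) \<le> b"
    and F: "F \<noteq> {}" "\<And>f. f \<in> F \<Longrightarrow> covered c f"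
      "\<And>f. f \<in> F \<Longrightarrow> (\<Sum>k\<in>{1..n}. u k * real (f k)) = b"
    and uniq: "\<And>z t. (\<And>f. f \<in> F \<Longrightarrow> (\<Sum>k\<in>{1..n}. z k * real (f k)) = t) \<Longrightarrow>
      \<exists>s. \<forall>k\<in>{1..n}. z k = s * u k"
  shows "of_int d * b - (\<Sum>k\<in>{1..n}. u k * a $ x k) = 1"
proof -
  let ?l = "\<lambda>f. labelled (\<lambda>k. real (f k))"
  have inner: "z \<bullet> ?l f = (\<Sum>k\<in>{1..n}. z $ x k * real (f k))" for z f
    unfolding inner_labels by (rule sum.cong) (simp_all add: labelled_nth)
  have inner_u: "labelled u \<bullet> y = (\<Sum>k\<in>{1..n}. u k * y $ x k)" for y
    unfolding inner_labels by (rule sum.cong) (simp_all add: labelled_nth)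
  have inner_uf: "labelled u \<bullet> ?l f = (\<Sum>k\<in>{1..n}. u k * real (f k))" for f
    unfolding inner by (rule sum.cong) (simp_all add: labelled_nth)
  have "of_int d * b - labelled u \<bullet> a = 1"
  proof (rule reflexive_facet[OF reflexive d_pos a_int _ _ b, where ?i0.0 = "x j" and F = "?l ` F"])
    show "labelled u $ i \<in> \<int>" for i
      using u(1) all_x_iff[of "\<lambda>i. labelled u $ i \<in> \<int>"] labelled_nth by metis
    show "\<bar>labelled u $ x j\<bar> = 1" using u(2,3) by (simp only: labelled_nth)
    have "D_vectors TYPE(real) (path_edges x) c \<subseteq> {y. labelled u \<bullet> y \<le> b}"
      unfolding D_vectors_covered using valid by (auto simp only: inner_uf mem_Collect_eq)
    then have "path_polytope c \<subseteq> {y. labelled u \<bullet> y \<le> b}"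
      by (intro hull_minimal convex_halfspace_le)
    then show "y \<in> path_polytope c \<Longrightarrow> labelled u \<bullet> y \<le> b" for y by blast
    have "?l ` F \<subseteq> D_vectors TYPE(real) (path_edges x) c"
      unfolding D_vectors_covered using F(2) by blast
    then show "?l ` F \<subseteq> path_polytope c" by (meson hull_subset order_trans)
    show "?l ` F \<noteq> {}" using F(1) by simp
    show "y \<in> ?l ` F \<Longrightarrow> labelled u \<bullet> y = b" for y using F(3) inner_uf by auto
    show "\<exists>s. z = s *\<^sub>R labelled u" if z: "\<And>y. y \<in> ?l ` F \<Longrightarrow> z \<bullet> y = t" for z t
    proof -
      have "\<exists>s. \<forall>k\<in>{1..n}. z $ x k = s * u k"
        by (rule uniq[where t = t]) (use z[OF imageI] inner in metis)
      then obtain s where "\<forall>k\<in>{1..n}. z $ x k = s * u k" by blast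
      then have "\<forall>i. z $ i = (s *\<^sub>R labelled u) $ i"
        by (subst all_x_iff) (simp add: labelled_nth)
      then show ?thesis by (auto simp: vec_eq_iff)
    qed
  qed
  then show ?thesis by (simp only: inner_u)
qed

lemma sum_upd:
  "i \<in> {1..n} \<Longrightarrow> (\<Sum>k\<in>{1..n}. z k * real (((\<lambda>_. 0)(i := m)) k)) = z i * real m"
  by (subst sum.remove[of _ i]) auto

lemma sum_upd2:
  assumes "i \<in> {1..n}" "j \<in> {1..n}" "i \<noteq> j"
  shows "(\<Sum>k\<in>{1..n}. z k * real (((\<lambda>_. 0)(i := m, j := 1)) k)) = z i * real m + z j"
proof -
  have "(\<Sum>k\<in>{1..n}. z k * real (((\<lambda>_. 0)(i := m, j := 1)) k)) =
    (\<Sum>k\<in>{1..n}. z k * real (((\<lambda>_. 0)(i := m)) k) + z k * real (((\<lambda>_. 0)(j := 1)) k))"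
    by (rule sum.cong) (use assms(3) in auto)
  then show ?thesis unfolding sum.distrib using assms sum_upd[of i z m] sum_upd[of j z 1] by simp
qed

text \<open>The origin and the unit vectors other than the \<open>j\<close>-th are always covered
  and span the hyperplane \<open>y_j = 0\<close>. Its height is \<open>0\<close>, so
  \<open>d\<close> drops out of the facet equation.\<close>

lemma translation_one:
  assumes j: "j \<in> {1..n}"
  shows "a $ x j = 1"
proof -
  define u where "u = (\<lambda>k. if k = j then - 1 else 0 :: real)"
  have u: "(\<Sum>k\<in>{1..n}. u k * z k) = - z j" for z
    using j by (subst sum.remove[of _ j]) (auto simp: u_def)
  let ?F = "insert (\<lambda>_. 0) ((\<lambda>i. (\<lambda>_. 0)(i := 1)) ` ({1..n} - {j}))"
  have "of_int d * 0 - (\<Sum>k\<in>{1..n}. u k * a $ x k) = 1"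
  proof (rule facet_equation[where F = ?F and j = j])
    show "(\<Sum>k\<in>{1..n}. u k * real (f k)) \<le> 0" for f unfolding u by simp
    show "f \<in> ?F \<Longrightarrow> covered c f" for f using covered_zero covered_unit by auto
    show "f \<in> ?F \<Longrightarrow> (\<Sum>k\<in>{1..n}. u k * real (f k)) = 0" for f
      unfolding u by (auto split: if_splits)
    show "\<exists>s. \<forall>k\<in>{1..n}. z k = s * u k"
      if *: "\<And>f. f \<in> ?F \<Longrightarrow> (\<Sum>k\<in>{1..n}. z k * real (f k)) = t" for z t
    proof -
      have t: "t = 0" using *[of "\<lambda>_. 0"] by simp
      have "z i = 0" if i: "i \<in> {1..n}" "i \<noteq> j" for i
        using *[of "(\<lambda>_. 0)(i := 1)"] sum_upd[of i z 1] i t by simp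
      then show ?thesis by (intro exI[of _ "- z j"]) (auto simp: u_def)
    qed
  qed (use j in \<open>auto simp: u_def sum_nonneg\<close>)
  then show ?thesis unfolding u by simp
qed

lemma subset_facet_equation:
  assumes T: "T \<subseteq> {1..n}" "T \<noteq> {}"
    and valid: "\<And>f. covered c f \<Longrightarrow> (\<Sum>k\<in>T. f k) \<le> h"
    and F: "F \<noteq> {}" "\<And>f. f \<in> F \<Longrightarrow> covered c f" "\<And>f. f \<in> F \<Longrightarrow> (\<Sum>k\<in>T. f k) = h"
    and uniq: "\<And>z t. (\<And>f. f \<in> F \<Longrightarrow> (\<Sum>k\<in>{1..n}. z k * real (f k)) = t) \<Longrightarrow>
      \<exists>s. \<forall>k\<in>{1..n}. z k = (if k \<in> T then s else 0)"
  shows "d * int h = int (card T) + 1"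
proof -
  define u where "u = (\<lambda>k. if k \<in> T then 1 else 0 :: real)"
  have u: "(\<Sum>k\<in>{1..n}. u k * z k) = (\<Sum>k\<in>T. z k)" for z
    using T(1) by (intro sum.mono_neutral_cong_right) (auto simp: u_def)
  obtain j where j: "j \<in> T" using T(2) by blast
  have "of_int d * real h - (\<Sum>k\<in>{1..n}. u k * a $ x k) = 1"
  proof (rule facet_equation[where F = F and j = j])
    show "covered c f \<Longrightarrow> (\<Sum>k\<in>{1..n}. u k * real (f k)) \<le> real h" for f
      unfolding u using valid[of f] by (simp flip: of_nat_sum)
    show "f \<in> F \<Longrightarrow> (\<Sum>k\<in>{1..n}. u k * real (f k)) = real h" for f
      unfolding u using F(3)[of f] by (simp flip: of_nat_sum)
    show "\<exists>s. \<forall>k\<in>{1..n}. z k = s * u k"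
      if "\<And>f. f \<in> F \<Longrightarrow> (\<Sum>k\<in>{1..n}. z k * real (f k)) = t" for z t
      using uniq[OF that] by (auto simp: u_def)
  qed (use T j F in \<open>auto simp: u_def\<close>)
  moreover have "(\<Sum>k\<in>T. a $ x k) = (\<Sum>k\<in>T. 1)"
    by (rule sum.cong) (use T translation_one in auto)
  ultimately have "of_int d * real h = real (card T) + 1" unfolding u by simp
  then have "(of_int (d * int h) :: real) = of_int (int (card T) + 1)" by simp
  then show ?thesis by (simp only: of_int_eq_iff)
qed

text \<open>The full star at \<open>i\<close>, alone and with a unit at each other vertex, gives
  \<open>n\<close> points spanning the hyperplane; the condition is the one under which
  \<open>covered_star_unit\<close> supplies them.\<close>

lemma singleton_facet_equation:
  assumes i: "i \<in> {1..n}"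
    and cond: "i + 2 \<noteq> n \<and> i \<noteq> 3 \<or> capacity c i < capacity c (i - 1) + capacity c (i + 1)"
  shows "d * int (star_capacity c i) = 2"
proof -
  let ?r = "star_capacity c i"
  let ?F = "insert ((\<lambda>_. 0)(i := ?r)) ((\<lambda>j. (\<lambda>_. 0)(i := ?r, j := 1)) ` ({1..n} - {i}))"
  have "d * int ?r = int (card {i}) + 1"
  proof (rule subset_facet_equation[where F = ?F])
    show "covered c f \<Longrightarrow> sum f {i} \<le> ?r" for f using covered_le_star_capacity i by simp
    show "f \<in> ?F \<Longrightarrow> covered c f" for f
      using covered_star[OF i] covered_star_unit[OF i _ _ cond] by blast
    show "\<exists>s. \<forall>k\<in>{1..n}. z k = (if k \<in> {i} then s else 0)"
      if *: "\<And>f. f \<in> ?F \<Longrightarrow> (\<Sum>k\<in>{1..n}. z k * real (f k)) = t" for z t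
    proof -
      have t: "t = z i * ?r" using *[of "(\<lambda>_. 0)(i := ?r)"] sum_upd[of i z ?r] i by simp
      have "z j = 0" if j: "j \<in> {1..n}" "j \<noteq> i" for j
        using *[of "(\<lambda>_. 0)(i := ?r, j := 1)"] sum_upd2[of i j z ?r] i j t by auto
      then show ?thesis by auto
    qed
  qed (use i in \<open>auto split: if_splits\<close>)
  then show ?thesis by simp
qed

text \<open>Here \<open>y\<^sub>3 \<le> c\<^sub>2 + c\<^sub>4\<close> is implied by \<open>y\<^sub>1 + y\<^sub>3 \<le> c\<^sub>2 + c\<^sub>4\<close>, so the facet belongs to
  \<open>{1, 3}\<close> instead of \<open>{3}\<close>; for \<open>n = 5\<close> it would belong to \<open>{1, 3, 5}\<close>.\<close>

lemma pair_facet_equation: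
  assumes n: "n \<noteq> 5" and le: "capacity c 2 + capacity c 4 \<le> capacity c 3"
  shows "d * int (capacity c 2 + capacity c 4) = 3"
proof -
  let ?h = "capacity c 2 + capacity c 4"
  have i: "3 \<in> {1..n}" using n_ge by simp
  have star: "star_capacity c 3 = ?h" using le by (simp add: star_capacity_def)
  have pos: "capacity c 2 > 0" using n_ge by (intro capacity_pos) auto
  \<comment> \<open>Trades one unit at vertex \<open>3\<close> for one at vertex \<open>1\<close>,
    which forces equal coefficients at the two vertices.\<close>
  let ?g = "(\<lambda>_. 0)(3 := ?h - 1, 1 := 1 :: nat)"
  let ?F = "insert ((\<lambda>_. 0)(3 := ?h)) (insert ?g
    ((\<lambda>j. (\<lambda>_. 0)(3 := ?h, j := 1)) ` ({1..n} - {1, 3})))"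
  have "d * int ?h = int (card {1::nat, 3}) + 1"
  proof (rule subset_facet_equation[where F = ?F])
    show "sum f {1, 3} \<le> ?h" if f: "covered c f" for f
    proof -
      have "\<exists>w. feasible n (capacity c) w \<and> (\<forall>k\<in>{1..n}. odd k \<longrightarrow> f k \<le> path_degree w k)"
        using f by (elim coveredE) blast
      then obtain w where w: "feasible n (capacity c) w"
        "\<And>k. k \<in> {1..n} \<Longrightarrow> odd k \<Longrightarrow> f k \<le> path_degree w k" by blast
      \<comment> \<open>The degrees of vertices \<open>1\<close> and \<open>3\<close> use the edges
        \<open>1\<close>, \<open>2\<close> and \<open>3\<close>: the first two are absorbed by
        vertex \<open>2\<close>, the last by vertex \<open>4\<close>.\<close>
      have "path_degree w 2 \<le> capacity c 2" using w(1) n_ge by (auto simp: feasible_def)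
      moreover have "w 3 \<le> capacity c 4" using feasible_le_capacity[OF w(1) i] by simp
      moreover have "w 0 = 0" using w(1) by (simp add: feasible_def)
      ultimately show ?thesis
        using w(2)[of 1] w(2)[of 3] n_ge by (simp add: path_degree_def)
    qed
    have 0: "covered c ((\<lambda>_. 0)(3 := ?h))" using covered_star[OF i] star by simp
    have 1: "covered c ((\<lambda>_. 0)(3 := (capacity c 2 - 1) + capacity c 4, 1 := 1))"
      using pos le n_ge by (intro covered_star_edge[where m = 1]) auto
    have "covered c ((\<lambda>_. 0)(3 := ?h, j := 1))" if j: "j \<in> {1..n}" "j \<noteq> 1" "j \<noteq> 3" for j
    proof (cases "odd j")
      case True
      then have "j \<noteq> 2" "j \<noteq> 4" by auto
      with j have "j \<ge> 5" by auto
      \<comment> \<open>Since \<open>n \<noteq> 5\<close>, vertex \<open>5\<close> is not an end, so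
        \<open>j\<close> has an edge that avoids the saturated vertex \<open>4\<close>.\<close>
      with le True j n show ?thesis
        by (intro covered_star_edge[where m = "if j < n then j else j - 1"])
          (auto split: if_splits)
    next
      case False
      show ?thesis by (rule covered_add_unit[OF 0, of 3]) (use False j in auto)
    qed
    moreover have "covered c ?g" using 1 pos by simp
    ultimately show "f \<in> ?F \<Longrightarrow> covered c f" for f using 0 by blast
    show "f \<in> ?F \<Longrightarrow> sum f {1, 3} = ?h" for f
      using pos by (auto split: if_splits)
    show "\<exists>s. \<forall>k\<in>{1..n}. z k = (if k \<in> {1, 3} then s else 0)"
      if *: "\<And>f. f \<in> ?F \<Longrightarrow> (\<Sum>k\<in>{1..n}. z k * real (f k)) = t" for z t
    proof -
      have t: "t = z 3 * ?h" using *[of "(\<lambda>_. 0)(3 := ?h)"] sum_upd[of 3 z ?h] i by simp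
      have "z 3 * (?h - 1) + z 1 = t" using *[of ?g] sum_upd2[of 3 1 z "?h - 1"] i by simp
      then have "z 1 = z 3" using t pos by (simp add: algebra_simps)
      moreover have "z j = 0" if j: "j \<in> {1..n}" "j \<noteq> 1" "j \<noteq> 3" for j
        using *[of "(\<lambda>_. 0)(3 := ?h, j := 1)"] sum_upd2[of 3 j z ?h] i j t by auto
      ultimately show ?thesis by (intro exI[of _ "z 3"]) auto
    qed
  qed (use n_ge in auto)
  then show ?thesis by simp
qed

text \<open>Reading the path backwards leaves its edge set, and hence the polytope, unchanged. Facts
  about vertex \<open>3\<close> thereby transfer to vertex \<open>n - 2\<close>.\<close>

lemma reversed: "gorenstein_path n (\<lambda>k. x (n + 1 - k)) c d a"
proof -
  have "bij_betw (\<lambda>k. n + 1 - k) {1..n} {1..n}"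
    by (rule bij_betw_byWitness[where f' = "\<lambda>k. n + 1 - k"]) auto
  from bij_betw_trans[OF this bij_x] have "bij_betw (\<lambda>k. x (n + 1 - k)) {1..n} UNIV"
    by (simp add: comp_def)
  then interpret r: path_labelling n "\<lambda>k. x (n + 1 - k)"
    using card_n n_ge by unfold_locales
  have edge: "{u, v} \<in> path_edges (\<lambda>k. x (n + 1 - k)) \<longleftrightarrow> {u, v} \<in> path_edges x" for u v
    unfolding path_edge_iff r.path_edge_iff
  proof safe
    fix i assume i: "1 \<le> i" "i < n"
    have "n + 1 - i = Suc (n - i)" "n + 1 - Suc i = n - i" "1 \<le> n - i" "n - i < n"
      using i by auto
    then show "\<exists>ia. 1 \<le> ia \<and> ia < n \<and> (x (n + 1 - i) = x ia \<and> x (n + 1 - Suc i) = x (Suc ia) \<or>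
        x (n + 1 - Suc i) = x ia \<and> x (n + 1 - i) = x (Suc ia))"
      "\<exists>ia. 1 \<le> ia \<and> ia < n \<and> (x (n + 1 - Suc i) = x ia \<and> x (n + 1 - i) = x (Suc ia) \<or>
        x (n + 1 - i) = x ia \<and> x (n + 1 - Suc i) = x (Suc ia))"
      by metis+
  next
    fix i assume i: "1 \<le> i" "i < n"
    have "n + 1 - (n - i) = Suc i" "n + 1 - Suc (n - i) = i" "1 \<le> n - i" "n - i < n"
      using i by auto
    then show "\<exists>ia. 1 \<le> ia \<and> ia < n \<and> (x i = x (n + 1 - ia) \<and> x (Suc i) = x (n + 1 - Suc ia) \<or>
        x (Suc i) = x (n + 1 - ia) \<and> x i = x (n + 1 - Suc ia))"
      "\<exists>ia. 1 \<le> ia \<and> ia < n \<and> (x (Suc i) = x (n + 1 - ia) \<and> x i = x (n + 1 - Suc ia) \<or>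
        x i = x (n + 1 - ia) \<and> x (Suc i) = x (n + 1 - Suc ia))"
      by metis+
  qed
  have "path_edges (\<lambda>k. x (n + 1 - k)) = path_edges x"
  proof (intro set_eqI iffI)
    fix e assume e: "e \<in> path_edges (\<lambda>k. x (n + 1 - k))"
    then obtain u v where "e = {u, v}" unfolding path_edges_def by blast
    with e edge show "e \<in> path_edges x" by simp
  next
    fix e assume e: "e \<in> path_edges x"
    then obtain u v where "e = {u, v}" unfolding path_edges_def by blast
    with e edge show "e \<in> path_edges (\<lambda>k. x (n + 1 - k))" by simp
  qed
  with reflexive c_pos d_pos a_int show ?thesis
    by unfold_locales simp_all
qed

lemma capacity_reversed:
  "k \<le> n + 1 \<Longrightarrow> path_labelling.capacity n (\<lambda>k. x (n + 1 - k)) c k = capacity c (n + 1 - k)"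
proof -
  interpret r: gorenstein_path n "\<lambda>k. x (n + 1 - k)" c d a by (rule reversed)
  show "k \<le> n + 1 \<Longrightarrow> r.capacity c k = capacity c (n + 1 - k)"
    unfolding r.capacity_def capacity_def by auto
qed

lemma dilation_cancel: "d * int p = m \<Longrightarrow> d * int q = m \<Longrightarrow> p = q"
  using d_pos by (metis less_irrefl mult_cancel_left of_nat_eq_iff)

text \<open>Otherwise the capacity of vertex \<open>3\<close> is so large that \<open>2\<close> and
  \<open>4\<close> satisfy the condition for singleton facets, so \<open>d\<close> times the sum of
  their capacities is \<open>4\<close>, while the pair facet gives \<open>3\<close>.\<close>

lemma capacity_three_less:
  assumes n: "n \<noteq> 5" "n \<ge> 4"
  shows "capacity c 3 < capacity c 2 + capacity c 4"
proof (rule ccontr)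
  assume not: "\<not> ?thesis"
  then have "d * int (capacity c 2 + capacity c 4) = 3"
    using pair_facet_equation n by simp
  moreover have "d * int (capacity c 2) = 2"
  proof -
    have "capacity c 2 < capacity c 1 + capacity c 3"
      using not capacity_pos[of 4] capacity_pos[of 1] n by auto
    then have "star_capacity c 2 = capacity c 2" "capacity c 2 < capacity c (2 - 1) + capacity c (2 + 1)"
      by (auto simp: star_capacity_def)
    with singleton_facet_equation[OF _ disjI2, of 2] n show ?thesis by simp
  qed
  moreover have "d * int (capacity c 4) = 2"
  proof -
    have "capacity c 4 < capacity c 3 + capacity c 5"
      using not capacity_pos[of 2] n by auto
    then have "star_capacity c 4 = capacity c 4" "capacity c 4 < capacity c (4 - 1) + capacity c (4 + 1)"
      by (auto simp: star_capacity_def)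
    with singleton_facet_equation[OF _ disjI2, of 4] n show ?thesis by simp
  qed
  ultimately show False by (simp add: algebra_simps)
qed

lemma all_singleton_facets:
  assumes n: "n \<noteq> 5" "n \<ge> 4" and i: "i \<in> {1..n}"
  shows "d * int (star_capacity c i) = 2"
proof -
  interpret r: gorenstein_path n "\<lambda>k. x (n + 1 - k)" c d a by (rule reversed)
  \<comment> \<open>Such an \<open>i\<close> is vertex \<open>3\<close> of the reversed
    path.\<close>
  have "capacity c i < capacity c (i - 1) + capacity c (i + 1)" if "i + 2 = n"
  proof -
    have "r.capacity c 3 < r.capacity c 2 + r.capacity c 4" by (rule r.capacity_three_less[OF n])
    moreover have "n + 1 - 3 = i" "n + 1 - 2 = i + 1" "n + 1 - 4 = i - 1" using that n i by auto
    ultimately show ?thesis using n capacity_reversed by simp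
  qed
  moreover have "capacity c i < capacity c (i - 1) + capacity c (i + 1)" if "i = 3"
    using capacity_three_less[OF n] that by simp
  ultimately show ?thesis by (intro singleton_facet_equation[OF i]) blast
qed

text \<open>All star capacities equal \<open>r\<close>. An inner vertex has two neighbours of
  capacity at least \<open>r\<close>, so the minimum must be its own capacity; an end may exceed
  \<open>r\<close>, since its single neighbour already limits it.\<close>

lemma capacities:
  assumes n: "n \<noteq> 5" "n \<ge> 4"
  obtains r where "d * int r = 2" "capacity c 1 \<ge> r" "capacity c n \<ge> r"
    "\<And>k. 1 < k \<Longrightarrow> k < n \<Longrightarrow> capacity c k = r"
proof -
  define r where "r = star_capacity c 1"
  have r: "d * int r = 2" unfolding r_def using n by (intro all_singleton_facets) auto
  have star: "star_capacity c i = r" if "i \<in> {1..n}" for i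
    using all_singleton_facets[OF n that] r by (rule dilation_cancel)
  have "r > 0" using r by (cases r) auto
  have ge: "capacity c i \<ge> r" if "i \<in> {1..n}" for i
    using star[OF that] by (simp add: star_capacity_def)
  have "capacity c k = r" if k: "1 < k" "k < n" for k
  proof -
    have "capacity c (k - 1) \<ge> r" "capacity c (k + 1) \<ge> r" using k by (auto intro!: ge)
    with star[of k] k \<open>r > 0\<close> show ?thesis by (auto simp: star_capacity_def)
  qed
  with that r ge n show thesis by simp
qed

text \<open>The singleton equations at \<open>1\<close>, \<open>2\<close>, \<open>4\<close>,
  \<open>5\<close> hold unconditionally. Vertex \<open>3\<close> has both ends at distance two, so
  its equation is available only if its capacity is below the \<open>2 * r\<close> of its
  neighbours.\<close>

lemma capacities_five:
  assumes n: "n \<le> 5" "n \<ge> 5"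
  obtains r where "d * int r = 2" "capacity c 1 \<ge> r" "capacity c 5 \<ge> r"
    "capacity c 2 = r" "capacity c 4 = r" "capacity c 3 = r \<or> capacity c 3 \<ge> 2 * r"
proof -
  define r where "r = star_capacity c 1"
  have r: "d * int r = 2" unfolding r_def using n by (intro singleton_facet_equation) auto
  have "star_capacity c 2 = r" "star_capacity c 4 = r" "star_capacity c 5 = r"
    by (rule dilation_cancel[OF singleton_facet_equation r]; use n in simp)+
  moreover have "capacity c 6 = 0" "capacity c 0 = 0"
    unfolding capacity_def using n by simp_all
  ultimately have *: "min (capacity c 1) (capacity c 2) = r"
    "min (capacity c 2) (capacity c 1 + capacity c 3) = r"
    "min (capacity c 4) (capacity c 3 + capacity c 5) = r"
    "min (capacity c 5) (capacity c 4) = r"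
    by (auto simp: r_def star_capacity_def)
  \<comment> \<open>The sums in the second and third minimum then exceed \<open>r\<close>, so these
    minima are the capacities of \<open>2\<close> and \<open>4\<close>.\<close>
  have "capacity c 3 > 0" using n by (intro capacity_pos) auto
  with * have c: "capacity c 1 \<ge> r" "capacity c 5 \<ge> r" "capacity c 2 = r" "capacity c 4 = r"
    by linarith+
  have "capacity c 3 = r" if "capacity c 3 < 2 * r"
  proof -
    have "star_capacity c 3 = capacity c 3" using c that by (simp add: star_capacity_def)
    moreover have "d * int (star_capacity c 3) = 2"
      by (rule singleton_facet_equation) (use c that n in auto)
    ultimately show ?thesis using r by (metis dilation_cancel)
  qed
  then have "capacity c 3 = r \<or> capacity c 3 \<ge> 2 * r" by linarith
  with that r c show thesis by blast
qed

text \<open>The middle vertex always has its singleton facet. If an end had capacity at least that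
  of the middle, the pair facet would give \<open>3\<close> instead of \<open>2\<close>; so both
  ends are smaller, have singleton facets themselves, and share the star capacity of the middle. But
  that is the minimum of the larger middle capacity and the sum of the two ends.\<close>

lemma n_not_three: "n \<noteq> 3"
proof
  assume "n = 3"
  then have n: "n \<le> 3" "n \<ge> 3" by simp_all
  interpret r: gorenstein_path n "\<lambda>k. x (n + 1 - k)" c d a by (rule reversed)
  have outside: "capacity c 0 = 0" "capacity c 4 = 0" "r.capacity c 4 = 0"
    unfolding capacity_def r.capacity_def using n by simp_all
  have rc: "r.capacity c 3 = capacity c 1" "r.capacity c 2 = capacity c 2"
  proof -
    have "n + 1 - 3 = 1" "n + 1 - 2 = 2" "3 \<le> n + 1" "2 \<le> n + 1" using n by linarith+
    with capacity_reversed show "r.capacity c 3 = capacity c 1" "r.capacity c 2 = capacity c 2"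
      by metis+
  qed
  have pos: "capacity c 1 > 0" "capacity c 3 > 0" by (rule capacity_pos, use n in simp)+
  have two: "d * int (star_capacity c 2) = 2" using n by (intro singleton_facet_equation) auto
  have le2: "star_capacity c 2 = min (capacity c 2) (capacity c 1 + capacity c 3)"
    by (simp add: star_capacity_def)
  have "capacity c 3 < capacity c 2"
  proof (rule ccontr)
    assume not: "\<not> ?thesis"
    then have "d * int (capacity c 2) = 3" using pair_facet_equation n outside by simp
    moreover have "star_capacity c 2 = capacity c 2" using not le2 by simp
    ultimately show False using two by simp
  qed
  moreover have "capacity c 1 < capacity c 2"
  proof (rule ccontr)
    assume not: "\<not> ?thesis"
    then have "d * int (capacity c 2) = 3" using r.pair_facet_equation n outside rc by simp
    moreover have "star_capacity c 2 = capacity c 2" using not le2 by simp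
    ultimately show False using two by simp
  qed
  ultimately have less: "capacity c 1 < capacity c (1 - 1) + capacity c (1 + 1)"
    "capacity c 3 < capacity c (3 - 1) + capacity c (3 + 1)"
    by (simp_all add: numeral_2_eq_2)
  have "d * int (star_capacity c 1) = 2" "d * int (star_capacity c 3) = 2"
    by (rule singleton_facet_equation[OF _ disjI2], use n in simp, rule less)+
  moreover have "star_capacity c 1 = capacity c 1" "star_capacity c 3 = capacity c 3"
    using less by (auto simp: star_capacity_def)
  ultimately have "capacity c 1 = star_capacity c 2" "capacity c 3 = star_capacity c 2"
    using two by (metis dilation_cancel)+
  then show False using le2 pos \<open>capacity c 1 < capacity c 2\<close> by linarith
qed

end

section \<open>Classification\<close>

context gorenstein_path
begin

text \<open>If \<open>n \<noteq> 5\<close> is odd, the odd vertices form a facet of height \<open>r (n - 1) / 2\<close> with \<open>d r = 2\<close>, and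
  the facet equation reads \<open>n - 1 = (n + 1) / 2 + 1\<close>.\<close>

lemma odd_n_five:
  assumes "odd n"
  shows "n = 5"
proof (rule ccontr)
  assume n5: "n \<noteq> 5"
  have n4: "n \<ge> 4" using n_ge n_not_three by linarith
  obtain r where r: "d * int r = 2" and c1: "capacity c 1 \<ge> r" "capacity c n \<ge> r"
    and c: "\<And>k. 1 < k \<Longrightarrow> k < n \<Longrightarrow> capacity c k = r"
    using capacities[OF n5 n4] by blast
  obtain m where m: "n = 2 * m + 1" using assms by (auto elim: oddE)
  define T where "T = {k \<in> {1..n}. odd k}"
  have "T = (\<lambda>i. 2 * i + 1) ` {..m}"
    unfolding T_def m by (auto simp: image_iff elim!: oddE)
  then have card_T: "card T = m + 1" by (simp add: card_image inj_on_def)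
  have "{k \<in> {1..n}. even k} = (\<lambda>i. 2 * i) ` {1..m}"
    unfolding m by (auto simp: image_iff elim!: evenE)
  then have card_even: "card {k \<in> {1..n}. even k} = m" by (simp add: card_image inj_on_def)
  have T: "finite T" "T \<subseteq> {1..n}" "1 \<in> T" using n_ge by (auto simp: T_def)
  have rpos: "r > 0" using r by (cases r) auto
  define p where "p k j = (if odd j \<and> j \<noteq> k then r else 0)" for k j :: nat
  have p_covered: "covered c (p k)" if k: "k \<in> T" for k
  proof -
    \<comment> \<open>Weight \<open>r\<close> on the perfect matching of the path without the odd
      vertex \<open>k\<close>: the edges \<open>1, 3, ..., k - 2\<close> to its left and
      \<open>k + 1, k + 3, ..., n - 1\<close> to its right.\<close>
    define w where "w i = (if odd i \<and> i < k \<or> even i \<and> k < i then r else 0)" for i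
    have deg: "path_degree w j \<le> r" if "j \<in> {1..n}" for j
      using that by (auto simp: path_degree_def w_def)
    have "path_degree w j \<le> capacity c j" if j: "j \<in> {1..n}" for j
    proof -
      have "r \<le> capacity c j"
        using j c1 c[of j] by (cases "j = 1 \<or> j = n") auto
      with deg[OF j] show ?thesis by linarith
    qed
    moreover have "w 0 = 0" "w n = 0" using k assms by (auto simp: w_def T_def)
    ultimately have w: "feasible n (capacity c) w" by (simp add: feasible_def)
    show ?thesis
    proof (rule coveredI[OF w w])
      fix j assume j: "j \<in> {1..n}" "odd j"
      then have "j < k \<or> k < j \<and> k < j - 1 \<or> j = k"
        using k by (auto simp: T_def elim!: oddE)
      with j show "p k j \<le> path_degree w j" by (auto simp: p_def path_degree_def w_def)
    qed (auto simp: p_def)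
  qed
  have sum_p: "(\<Sum>j\<in>T. p k j) = r * m" if k: "k \<in> T" for k
  proof -
    have "(\<Sum>j\<in>T. p k j) = (\<Sum>j\<in>T - {k}. r)"
      using T(1) by (intro sum.mono_neutral_cong_right) (auto simp: p_def T_def)
    then show ?thesis using k T(1) card_T by simp
  qed
  have sum_zp: "(\<Sum>j\<in>{1..n}. z j * real (p k j)) = (sum z T - z k) * r" if k: "k \<in> T" for k z
  proof -
    have "(\<Sum>j\<in>{1..n}. z j * real (p k j)) = (\<Sum>j\<in>T - {k}. z j * r)"
      using T(1,2) by (intro sum.mono_neutral_cong_right) (auto simp: p_def T_def)
    then show ?thesis using k T(1) by (simp add: sum_diff1 flip: sum_distrib_right)
  qed
  \<comment> \<open>The \<open>m + 1\<close> vectors \<open>p k\<close> make \<open>z\<close>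
    constant on the odd vertices, and the \<open>m\<close> added units make it vanish on the even
    ones: \<open>n\<close> points spanning the hyperplane.\<close>
  let ?F = "p ` T \<union> (\<lambda>j. (p 1)(j := 1)) ` {k \<in> {1..n}. even k}"
  have "d * int (r * m) = int (card T) + 1"
  proof (rule subset_facet_equation[where F = ?F])
    show "sum f T \<le> r * m" if f: "covered c f" for f
    proof -
      have "\<exists>w. feasible n (capacity c) w \<and> (\<forall>k\<in>{1..n}. odd k \<longrightarrow> f k \<le> path_degree w k)"
        using f by (elim coveredE) blast
      then obtain w where w: "feasible n (capacity c) w"
        "\<And>k. k \<in> {1..n} \<Longrightarrow> odd k \<Longrightarrow> f k \<le> path_degree w k" by blast
      have "sum f T \<le> (\<Sum>k\<in>T. path_degree w k)"
        using w(2) by (intro sum_mono) (auto simp: T_def)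
      also have "\<dots> = (\<Sum>k\<in>{1..n}. if odd k then path_degree w k else 0)"
        unfolding T_def by (rule sum.inter_filter) simp
      also have "\<dots> = (\<Sum>k\<in>{1..n}. if even k then path_degree w k else 0)"
        using w(1) by (simp only: sum_path_degree_even sum_path_degree_odd feasible_def)
      also have "\<dots> = (\<Sum>k | k \<in> {1..n} \<and> even k. path_degree w k)"
        by (rule sum.inter_filter[symmetric]) simp
      also have "\<dots> \<le> (\<Sum>k | k \<in> {1..n} \<and> even k. r)"
      proof (rule sum_mono)
        fix k assume k: "k \<in> {k \<in> {1..n}. even k}"
        \<comment> \<open>As \<open>n\<close> is odd, even vertices are inner and have capacity
          exactly \<open>r\<close>.\<close>
        have "k \<noteq> 1" "k \<noteq> n" using k assms by auto
        with k have "capacity c k = r" by (intro c) auto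
        with k w(1) show "path_degree w k \<le> r" unfolding feasible_def by force
      qed
      also have "\<dots> = r * m" using card_even by simp
      finally show ?thesis .
    qed
    have "covered c ((p 1)(j := 1))" if "j \<in> {1..n}" "even j" for j
      by (rule covered_add_unit[OF p_covered[OF T(3)], of 1]) (use that in \<open>auto simp: p_def\<close>)
    then show "f \<in> ?F \<Longrightarrow> covered c f" for f using p_covered by blast
    have "sum ((p 1)(j := 1)) T = sum (p 1) T" if "even j" for j
      by (rule sum.cong) (use that in \<open>auto simp: T_def\<close>)
    then show "f \<in> ?F \<Longrightarrow> sum f T = r * m" for f using sum_p T(3) by auto
    show "\<exists>s. \<forall>k\<in>{1..n}. z k = (if k \<in> T then s else 0)"
      if *: "\<And>f. f \<in> ?F \<Longrightarrow> (\<Sum>k\<in>{1..n}. z k * real (f k)) = t" for z t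
    proof -
      have 1: "(sum z T - z k) * r = t" if k: "k \<in> T" for k
        using *[of "p k"] sum_zp[OF k] k by auto
      define s where "s = sum z T - t / r"
      have "z k = s" if "k \<in> T" for k
        using 1[OF that] rpos by (auto simp: s_def field_simps)
      moreover have "z j = 0" if j: "j \<in> {1..n}" "j \<notin> T" for j
      proof -
        have ev: "even j" using j by (auto simp: T_def)
        have "(\<Sum>k\<in>{1..n}. z k * real (((p 1)(j := 1)) k)) =
          (\<Sum>k\<in>{1..n}. z k * real (p 1 k) + z k * real (((\<lambda>_. 0)(j := 1)) k))"
          by (rule sum.cong) (use ev in \<open>auto simp: p_def\<close>)
        also have "\<dots> = t + z j"
          unfolding sum.distrib sum_zp[OF T(3)] 1[OF T(3)] using sum_upd[OF j(1), of z 1] by simp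
        finally have "(\<Sum>k\<in>{1..n}. z k * real (((p 1)(j := 1)) k)) = t + z j" .
        moreover have "(p 1)(j := 1) \<in> ?F" using ev j by blast
        ultimately show ?thesis using *[of "(p 1)(j := 1)"] by linarith
      qed
      ultimately have "\<forall>k\<in>{1..n}. z k = (if k \<in> T then s else 0)" by simp
      then show ?thesis by blast
    qed
  qed (use T in auto)
  then have "d * int r * int m = int m + 2" using card_T by (simp add: mult.assoc)
  with r m n5 show False by simp
qed

end

section \<open>Polytopes for the remaining capacities\<close>

context capacitated_path
begin

text \<open>Under \<open>cov\<close> the vectors are exactly the integral points of the truncated
  box, whose hull is the box by \<open>truncated_box_integral\<close>.\<close>

lemma convex_hull_D_vectors:
  assumes T: "T \<subseteq> {1..n}"
    and cov: "\<And>f. covered c f \<longleftrightarrow> (\<forall>k\<in>{1..n}. f k \<le> B k) \<and> (\<Sum>k\<in>T. f k) \<le> h"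
    and C: "\<And>k. k \<in> {1..n} \<Longrightarrow> C (x k) = real (B k)"
  shows "convex hull (D_vectors TYPE('k::field) (path_edges x) c) = truncated_box C (x ` T) (real h)"
proof -
  have sum_T: "(\<Sum>i\<in>x ` T. y $ i) = (\<Sum>k\<in>T. y $ x k)" for y :: "real ^ 'n"
    using T bij_x by (subst sum.reindex) (auto simp: bij_betw_def intro: inj_on_subset)
  have mem: "y \<in> truncated_box C (x ` T) (real h) \<longleftrightarrow>
      (\<forall>k\<in>{1..n}. 0 \<le> y $ x k \<and> y $ x k \<le> real (B k)) \<and> (\<Sum>k\<in>T. y $ x k) \<le> real h" for y
    unfolding truncated_box_def mem_Collect_eq sum_T by (subst all_x_iff) (use C in auto)
  have "D_vectors TYPE('k) (path_edges x) c = {y \<in> truncated_box C (x ` T) (real h). \<forall>i. y $ i \<in> \<int>}"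
    unfolding D_vectors_covered
  proof (intro set_eqI iffI)
    fix y assume "y \<in> {labelled (\<lambda>k. real (f k)) |f. covered c f}"
    then obtain f where f: "covered c f" and y: "\<And>k. k \<in> {1..n} \<Longrightarrow> y $ x k = real (f k)"
      using labelled_nth by blast
    have "(\<Sum>k\<in>T. y $ x k) = (\<Sum>k\<in>T. real (f k))"
      by (rule sum.cong) (use T y in auto)
    then have "y \<in> truncated_box C (x ` T) (real h)"
      unfolding mem using f y by (auto simp: cov simp flip: of_nat_sum)
    moreover have "\<forall>i. y $ i \<in> \<int>" by (subst all_x_iff) (use y in auto)
    ultimately show "y \<in> {y \<in> truncated_box C (x ` T) (real h). \<forall>i. y $ i \<in> \<int>}" by blast
  next
    fix y assume y: "y \<in> {y \<in> truncated_box C (x ` T) (real h). \<forall>i. y $ i \<in> \<int>}"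
    define f where "f k = nat \<lfloor>y $ x k\<rfloor>" for k
    have f: "y $ x k = real (f k)" if "k \<in> {1..n}" for k
    proof -
      have "0 \<le> y $ x k" "y $ x k \<in> \<int>" using y that unfolding mem mem_Collect_eq by auto
      then show ?thesis by (auto simp: f_def elim!: Ints_cases)
    qed
    have "(\<Sum>k\<in>T. y $ x k) = (\<Sum>k\<in>T. real (f k))"
      by (rule sum.cong) (use T f in auto)
    then have "covered c f"
      using y f unfolding cov mem mem_Collect_eq by (auto simp flip: of_nat_sum)
    moreover have "y = labelled (\<lambda>k. real (f k))" by (rule labelled_eqI) (rule f)
    ultimately show "y \<in> {labelled (\<lambda>k. real (f k)) |f. covered c f}" by blast
  qed
  moreover have "C i \<in> \<int>" for i using C all_x_iff[of "\<lambda>i. C i \<in> \<int>"] by auto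
  ultimately show ?thesis using truncated_box_integral[of C "real h" "x ` T"] by simp
qed

text \<open>For even \<open>n\<close> the odd-numbered edges form a perfect matching, and weight
  \<open>r\<close> on it reaches the corner of the cube. Larger end capacities do not help, because
  the neighbour of an end has capacity \<open>r\<close>.\<close>

lemma cube_D_vectors:
  assumes "even n" "capacity c 1 \<ge> r" "capacity c n \<ge> r" "\<And>k. 1 < k \<Longrightarrow> k < n \<Longrightarrow> capacity c k = r"
  shows "convex hull (D_vectors TYPE('k::field) (path_edges x) c) = truncated_box (\<lambda>_. real r) {} 0"
proof -
  have n4: "n \<ge> 4" using n_ge assms(1) by (cases "n = 3") auto
  have "covered c f \<longleftrightarrow> (\<forall>k\<in>{1..n}. f k \<le> r) \<and> (\<Sum>k\<in>{}. f k) \<le> 0" for f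
  proof
    assume f: "covered c f"
    have "star_capacity c k \<le> r" if k: "k \<in> {1..n}" for k
    proof -
      consider "k = 1" | "k = n" | "1 < k \<and> k < n" using k by fastforce
      then show ?thesis
      proof cases
        case 1
        then show ?thesis using assms(4)[of 2] n4 by (simp add: star_capacity_def numeral_2_eq_2)
      next
        case 2
        then show ?thesis using assms(4)[of "n - 1"] n4 by (simp add: star_capacity_def)
      next
        case 3
        then show ?thesis using assms(4)[of k] by (simp add: star_capacity_def)
      qed
    qed
    then have "f k \<le> r" if "k \<in> {1..n}" for k
      using covered_le_star_capacity[OF f that] that le_trans by blast
    then show "(\<forall>k\<in>{1..n}. f k \<le> r) \<and> (\<Sum>k\<in>{}. f k) \<le> 0" by simp
  next
    assume f: "(\<forall>k\<in>{1..n}. f k \<le> r) \<and> (\<Sum>k\<in>{}. f k) \<le> 0"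
    define w where "w i = (if odd i then r else 0)" for i :: nat
    have deg: "path_degree w j = r" if "j \<in> {1..n}" for j
      using that by (auto simp: path_degree_def w_def)
    have "r \<le> capacity c j" if "j \<in> {1..n}" for j
      using that assms(2,3) assms(4)[of j] by (cases "j = 1 \<or> j = n") auto
    then have w: "feasible n (capacity c) w" using assms(1) deg by (simp add: feasible_def w_def)
    show "covered c f" by (rule coveredI[OF w w]) (use f deg in auto)
  qed
  from convex_hull_D_vectors[OF _ this, of "\<lambda>_. real r"] show ?thesis by simp
qed

text \<open>Everything at the odd vertices is absorbed by \<open>2\<close> and \<open>4\<close>, of
  joint capacity \<open>2 * r\<close>; so a capacity of vertex \<open>3\<close> beyond
  \<open>2 * r\<close> has no effect, which explains \<open>s\<close>.\<close>

lemma five_D_vectors: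
  assumes n: "n \<le> 5" "5 \<le> n" and c: "capacity c 1 \<ge> r" "capacity c 5 \<ge> r" "capacity c 2 = r" "capacity c 4 = r"
    and s: "s = min (capacity c 3) (2 * r)"
  shows "convex hull (D_vectors TYPE('k::field) (path_edges x) c) =
    truncated_box (\<lambda>i. if i = x 3 then real s else real r) (x ` {1, 3, 5}) (real (2 * r))"
proof -
  have range: "k \<in> {1..n} \<longleftrightarrow> k = 1 \<or> k = 2 \<or> k = 3 \<or> k = 4 \<or> k = 5" for k
    using n by auto
  have feasible_iff: "feasible n (capacity c) w \<longleftrightarrow> w 0 = 0 \<and> w 5 = 0 \<and> w 1 \<le> capacity c 1 \<and>
     w 1 + w 2 \<le> r \<and> w 2 + w 3 \<le> capacity c 3 \<and> w 3 + w 4 \<le> r \<and> w 4 \<le> capacity c 5" for w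
  proof -
    have n5: "w n = w 5" using n by (metis le_antisym)
    have set: "{1..n} = {1, 2, 3, 4, 5}" using n by auto
    show ?thesis
      unfolding feasible_def set n5 by (auto simp: path_degree_def c(3,4))
  qed
  have cov: "covered c f \<longleftrightarrow> (\<forall>k\<in>{1..n}. f k \<le> (if k = 3 then s else r)) \<and> (\<Sum>k\<in>{1, 3, 5}. f k) \<le> 2 * r" for f
  proof
    assume f: "covered c f"
    then obtain w1 w2 where w: "feasible n (capacity c) w1" "feasible n (capacity c) w2"
      "\<And>k. k \<in> {1..n} \<Longrightarrow> odd k \<Longrightarrow> f k \<le> path_degree w1 k"
      "\<And>k. k \<in> {1..n} \<Longrightarrow> even k \<Longrightarrow> f k \<le> path_degree w2 k"
      by (metis coveredE)
    have "f 1 \<le> w1 1" "f 3 \<le> w1 2 + w1 3" "f 5 \<le> w1 4" "f 2 \<le> w2 1 + w2 2" "f 4 \<le> w2 3 + w2 4"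
      using w(3)[of 1] w(3)[of 3] w(3)[of 5] w(4)[of 2] w(4)[of 4] w(1)
      unfolding range feasible_iff path_degree_def by simp_all
    with w(1,2) show "(\<forall>k\<in>{1..n}. f k \<le> (if k = 3 then s else r)) \<and> (\<Sum>k\<in>{1, 3, 5}. f k) \<le> 2 * r"
      unfolding Ball_def range feasible_iff by (auto simp: s)
  next
    assume f: "(\<forall>k\<in>{1..n}. f k \<le> (if k = 3 then s else r)) \<and> (\<Sum>k\<in>{1, 3, 5}. f k) \<le> 2 * r"
    then have f': "f 1 \<le> r" "f 2 \<le> r" "f 3 \<le> s" "f 4 \<le> r" "f 5 \<le> r" "f 1 + f 3 + f 5 \<le> 2 * r"
      unfolding Ball_def range by auto
    \<comment> \<open>Vertex \<open>3\<close> first takes what vertex \<open>1\<close> leaves free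
      at vertex \<open>2\<close>; the rest goes to vertex \<open>4\<close>, where the sum constraint
      leaves room for it beside \<open>f 5\<close>.\<close>
    define w2 where "w2 = min (f 3) (r - f 1)"
    let ?w = "(\<lambda>_. 0)(1 := f 1, 2 := w2, 3 := f 3 - w2, 4 := f 5)"
    \<comment> \<open>The even vertices are saturated from the two ends, without using vertex
      \<open>3\<close>.\<close>
    let ?v = "(\<lambda>_. 0)(1 := r, 4 := r)"
    have w: "feasible n (capacity c) ?w"
      unfolding feasible_iff using f' c(1,2) s by (auto simp: w2_def)
    have v: "feasible n (capacity c) ?v"
      unfolding feasible_iff using c(1,2) by auto
    show "covered c f"
      by (rule coveredI[OF w v]; unfold range) (use f' in \<open>auto simp: path_degree_def w2_def\<close>)
  qed
  have "1 \<in> {1..n}" "3 \<in> {1..n}" "5 \<in> {1..n}" using n by auto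
  then have "x k = x 3 \<longleftrightarrow> k = 3" if "k \<in> {1..n}" for k using that x_eq_iff by blast
  then show ?thesis
    using n by (intro convex_hull_D_vectors[OF _ cov]) auto
qed

end

text \<open>A bound \<open>y_i \<le> h\<close> with \<open>i\<close> in \<open>T\<close> follows
  from the sum constraint, so it is left out of \<open>U\<close>. With
  \<open>a = (1, ..., 1)\<close> the remaining normals need heights \<open>0\<close>,
  \<open>2 / d = r\<close> and, for three elements in \<open>T\<close>,
  \<open>4 / d = 2 r\<close>.\<close>

lemma gorenstein_truncated_box:
  fixes C :: "'n::finite \<Rightarrow> real" and r :: nat
  assumes dr: "d * int r = 2" and C: "\<And>i. C i = real r \<or> i \<in> T \<and> C i = h" and i0: "C i0 = real r"
    and T: "T = {} \<and> h = 0 \<or> card T = 3 \<and> h = 2 * real r"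
  shows "gorenstein_polytope (truncated_box C T h)"
proof -
  define eT :: "real ^ 'n" where "eT = (\<chi> i. if i \<in> T then 1 else 0)"
  define a :: "real ^ 'n" where "a = (\<chi> i. 1)"
  define U where "U = range (\<lambda>i. - axis i 1) \<union> (\<lambda>i. axis i 1) ` {i. C i = real r} \<union> (if T = {} then {} else {eT})"
  \<comment> \<open>The identity \<open>d * b u = 1 + u \<bullet> a\<close> solved for
    \<open>b\<close>, with \<open>1 / d = r / 2\<close>.\<close>
  define b where "b u = real r / 2 * (1 + u \<bullet> a)" for u
  have r: "r > 0" using dr by (cases r) auto
  have d: "d > 0" using dr r by (metis of_nat_0_less_iff zero_less_mult_pos2 zero_less_numeral)
  have dr': "of_int d * real r = 2" using arg_cong[OF dr, of real_of_int] by simp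
  have eT: "eT \<bullet> y = (\<Sum>i\<in>T. y $ i)" for y
    unfolding inner_vec_def eT_def by (rule sum.mono_neutral_cong_right) auto
  have ax: "axis i 1 \<bullet> y = y $ i" for i and y :: "real ^ 'n" by (simp add: inner_axis')
  have int: "C i \<in> \<int>" "h \<in> \<int>" for i using C[of i] T by auto
  have halfspaces: "truncated_box C T h = {y. \<forall>u\<in>U. u \<bullet> y \<le> b u}"
  proof -
    have "(\<forall>u\<in>U. u \<bullet> y \<le> b u) \<longleftrightarrow> (\<forall>i. 0 \<le> y $ i) \<and> (\<forall>i. C i = real r \<longrightarrow> y $ i \<le> real r) \<and>
        (T \<noteq> {} \<longrightarrow> (\<Sum>i\<in>T. y $ i) \<le> 2 * real r)" for y
      unfolding U_def using T by (auto simp: ball_Un ax eT b_def a_def)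
    also have "\<dots> y \<longleftrightarrow> y \<in> truncated_box C T h" for y
    proof
      assume y: "(\<forall>i. 0 \<le> y $ i) \<and> (\<forall>i. C i = real r \<longrightarrow> y $ i \<le> real r) \<and>
        (T \<noteq> {} \<longrightarrow> (\<Sum>i\<in>T. y $ i) \<le> 2 * real r)"
      then have sum: "(\<Sum>i\<in>T. y $ i) \<le> h" using T by auto
      have "y $ i \<le> C i" for i
        using C[of i] y member_le_sum[of i T "($) y"] sum by force
      with y sum show "y \<in> truncated_box C T h" by (auto simp: truncated_box_def)
    next
      assume y: "y \<in> truncated_box C T h"
      then have "y $ i \<le> C i" for i by (simp add: truncated_box_def)
      then have "y $ i \<le> real r" if "C i = real r" for i using that by metis
      then show "(\<forall>i. 0 \<le> y $ i) \<and> (\<forall>i. C i = real r \<longrightarrow> y $ i \<le> real r) \<and>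
        (T \<noteq> {} \<longrightarrow> (\<Sum>i\<in>T. y $ i) \<le> 2 * real r)"
        using y T by (auto simp: truncated_box_def)
    qed
    finally show ?thesis by blast
  qed
  show ?thesis
  proof (rule gorenstein_polytopeI[OF _ _ truncated_box_integral _ _ _ halfspaces d])
    show "finite {y \<in> truncated_box C T h. \<forall>i. y $ i \<in> \<int>}"
      by (rule finite_subset[OF _ finite_integral_box[of C]]) (auto simp: truncated_box_def)
    show "finite U" by (simp add: U_def)
    show "u $ i \<in> \<int>" if "u \<in> U" for u i
      using that by (auto simp: U_def axis_def eT_def split: if_splits)
    \<comment> \<open>The coordinate \<open>i0\<close> keeps its upper bound, so \<open>U\<close>
      contains two opposite normals with midpoint \<open>0\<close>.\<close>
    have "axis i0 1 \<in> convex hull U" "- axis i0 1 \<in> convex hull U"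
      using i0 by (auto simp: U_def intro!: hull_inc)
    then have "(1 / 2) *\<^sub>R axis i0 1 + (1 / 2) *\<^sub>R (- axis i0 1) \<in> convex hull U"
      by (intro convexD[OF convex_convex_hull]) auto
    then show "0 \<in> convex hull U" by simp
    show "of_int d * b u = 1 + u \<bullet> a" for u using dr' by (simp add: b_def field_simps)
  qed (use int in \<open>auto simp: a_def\<close>)
qed

section \<open>Matching the hulls with the listed polytopes\<close>

context path_labelling
begin

lemma gorenstein_pathE:
  assumes "P \<in> gorenstein_D_polytopes TYPE('k::field) (path_edges x)"
  obtains c d a where "gorenstein_path n x c d a" "P = convex hull (D_vectors TYPE('k) (path_edges x) c)"
proof -
  obtain c where c: "\<And>i. c $ i > 0" and P: "P = convex hull (D_vectors TYPE('k) (path_edges x) c)"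
    and G: "gorenstein_polytope P"
    using assms by (auto simp: gorenstein_D_polytopes_def)
  obtain d a where d: "d > 0" "\<forall>i. a $ i \<in> \<int>" "reflexive_polytope ((\<lambda>y. of_int d *\<^sub>R y - a) ` P)"
    using G unfolding gorenstein_polytope_def by blast
  interpret capacitated_path n x c using c by unfold_locales
  \<comment> \<open>The change of field: the description by coverings does not mention it.\<close>
  have "P = path_polytope c" unfolding P D_vectors_covered ..
  with d have "gorenstein_path n x c d a" by unfold_locales simp_all
  with P that show thesis by blast
qed

lemma unit_cube_box: "unit_cube = truncated_box (\<lambda>_. real 1) {} 0"
  by (simp add: unit_cube_def truncated_box_def)

lemma shifted_centred_cube_box:
  "(\<lambda>y. y + (\<chi> i. 1)) ` centred_cube = truncated_box (\<lambda>_. real 2) {} 0" (is "?l = ?r")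
proof -
  have "?l = (\<lambda>y. 2 *\<^sub>R y) ` unit_cube" by (simp add: centred_cube_def image_image)
  also have "\<dots> = ?r"
  proof (intro set_eqI iffI)
    fix y :: "real ^ 'a" assume "y \<in> ?r"
    then have "(1 / 2) *\<^sub>R y \<in> unit_cube" by (auto simp: unit_cube_def truncated_box_def)
    moreover have "y = 2 *\<^sub>R ((1 / 2) *\<^sub>R y)" by simp
    ultimately show "y \<in> (\<lambda>y. 2 *\<^sub>R y) ` unit_cube" by blast
  qed (auto simp: unit_cube_def truncated_box_def)
  finally show ?thesis .
qed

lemma dilation_cases: "(d :: int) > 0 \<Longrightarrow> d * int r = 2 \<Longrightarrow> r = 1 \<or> r = 2"
  using dvd_imp_le[of r 2] by (metis One_nat_def dvd_triv_right int_dvd_int_iff le_Suc_eq le_zero_eq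
      mult_zero_right of_nat_0 of_nat_numeral one_add_one pos2 zero_neq_numeral plus_1_eq_Suc)

lemma gorenstein_D_polytopes_even:
  assumes "even n"
  shows "gorenstein_D_polytopes TYPE('k::field) (path_edges x) =
    {truncated_box (\<lambda>_. real 1) {} 0, truncated_box (\<lambda>_. real 2) {} 0}"
proof (intro set_eqI iffI)
  fix P assume "P \<in> gorenstein_D_polytopes TYPE('k) (path_edges x)"
  then obtain c d a where g: "gorenstein_path n x c d a"
    and P: "P = convex hull (D_vectors TYPE('k) (path_edges x) c)"
    by (rule gorenstein_pathE)
  interpret gorenstein_path n x c d a by (rule g)
  have "n \<noteq> 5" "n \<noteq> 3" using assms by auto
  then have "n \<ge> 4" using n_ge by linarith
  obtain r where r: "d * int r = 2" "capacity c 1 \<ge> r" "capacity c n \<ge> r"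
    "\<And>k. 1 < k \<Longrightarrow> k < n \<Longrightarrow> capacity c k = r"
    using capacities[OF \<open>n \<noteq> 5\<close> \<open>n \<ge> 4\<close>] by blast
  then have "P = truncated_box (\<lambda>_. real r) {} 0" unfolding P using assms by (intro cube_D_vectors)
  then show "P \<in> {truncated_box (\<lambda>_. real 1) {} 0, truncated_box (\<lambda>_. real 2) {} 0}"
    using dilation_cases[OF d_pos r(1)] by auto
next
  have *: "truncated_box (\<lambda>_. real r) {} 0 \<in> gorenstein_D_polytopes TYPE('k) (path_edges x)"
    if "d * int r = 2" for d r
  proof -
    have r: "r > 0" using that by (cases r) auto
    define c :: "nat ^ 'n" where "c = (\<chi> i. r)"
    interpret capacitated_path n x c using r by unfold_locales (simp add: c_def)
    have "capacity c k = r" if "k \<in> {1..n}" for k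
      unfolding capacity_def using that by (simp add: c_def)
    then have "convex hull (D_vectors TYPE('k) (path_edges x) c) = truncated_box (\<lambda>_. real r) {} 0"
      using assms n_ge by (intro cube_D_vectors) auto
    moreover have "gorenstein_polytope (truncated_box (\<lambda>_ :: 'n. real r) {} 0)"
      by (rule gorenstein_truncated_box[OF that]) auto
    ultimately show ?thesis using c_pos unfolding gorenstein_D_polytopes_def by blast
  qed
  fix P assume "P \<in> {truncated_box (\<lambda>_ :: 'n. real 1) {} 0, truncated_box (\<lambda>_. real 2) {} 0}"
  then show "P \<in> gorenstein_D_polytopes TYPE('k) (path_edges x)"
    using *[of 2 1] *[of 1 2] by auto
qed

text \<open>\<open>s\<close> bounds the third coordinate: \<open>s = r\<close> is the case of a
  small third capacity, while for \<open>s = 2 * r\<close> that bound is implied by the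
  others.\<close>

definition five_box :: "nat \<Rightarrow> nat \<Rightarrow> (real ^ 'n) set" where
  "five_box r s = truncated_box (\<lambda>i. if i = x 3 then real s else real r) (x ` {1, 3, 5}) (real (2 * r))"

lemma gorenstein_D_polytopes_five:
  assumes n: "n \<le> 5" "5 \<le> n"
  shows "gorenstein_D_polytopes TYPE('k::field) (path_edges x) =
    {five_box 1 1, five_box 1 2, five_box 2 2, five_box 2 4}"
proof (intro set_eqI iffI)
  fix P assume "P \<in> gorenstein_D_polytopes TYPE('k) (path_edges x)"
  then obtain c d a where g: "gorenstein_path n x c d a"
    and P: "P = convex hull (D_vectors TYPE('k) (path_edges x) c)"
    by (rule gorenstein_pathE)
  interpret gorenstein_path n x c d a by (rule g)
  obtain r where r: "d * int r = 2" "capacity c 1 \<ge> r" "capacity c 5 \<ge> r"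
    "capacity c 2 = r" "capacity c 4 = r" "capacity c 3 = r \<or> capacity c 3 \<ge> 2 * r"
    using capacities_five[OF n] by blast
  have "P = five_box r (min (capacity c 3) (2 * r))"
    unfolding P five_box_def using n r by (intro five_D_vectors) auto
  then show "P \<in> {five_box 1 1, five_box 1 2, five_box 2 2, five_box 2 4}"
    using dilation_cases[OF d_pos r(1)] r(6) by (auto simp: min_def split: if_splits)
next
  have range: "1 \<in> {1..n}" "2 \<in> {1..n}" "3 \<in> {1..n}" "4 \<in> {1..n}" "5 \<in> {1..n}" using n by auto
  have neq: "x 1 \<noteq> x 3" "x 2 \<noteq> x 3" "x 4 \<noteq> x 3" "x 5 \<noteq> x 3" "x 1 \<noteq> x 5"
    using x_eq_iff range by auto
  have *: "five_box r s \<in> gorenstein_D_polytopes TYPE('k) (path_edges x)"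
    if dr: "d * int r = 2" and s: "s = r \<or> s = 2 * r" for d r s
  proof -
    have r: "r > 0" using dr by (cases r) auto
    define c :: "nat ^ 'n" where "c = (\<chi> i. if i = x 3 then s else r)"
    interpret capacitated_path n x c using r s by unfold_locales (auto simp: c_def)
    have "capacity c k = (if x k = x 3 then s else r)" if "k \<in> {1..n}" for k
      unfolding capacity_def using that by (simp add: c_def)
    with range neq have "capacity c 1 = r" "capacity c 2 = r" "capacity c 3 = s"
      "capacity c 4 = r" "capacity c 5 = r" by simp_all
    then have "convex hull (D_vectors TYPE('k) (path_edges x) c) = five_box r s"
      unfolding five_box_def using n s by (intro five_D_vectors) auto
    moreover have "gorenstein_polytope (five_box r s)"
      unfolding five_box_def
      by (rule gorenstein_truncated_box[OF dr, where ?i0.0 = "x 1"]) (use s neq in auto)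
    ultimately show ?thesis using c_pos unfolding gorenstein_D_polytopes_def by blast
  qed
  fix P assume "P \<in> {five_box 1 1, five_box 1 2, five_box 2 2, five_box 2 4}"
  then show "P \<in> gorenstein_D_polytopes TYPE('k) (path_edges x)"
    using *[of 2 1 1] *[of 2 1 2] *[of 1 2 2] *[of 1 2 4] by auto
qed

lemma mem_five_box:
  assumes n: "n \<le> 5" "5 \<le> n"
  shows "y \<in> five_box r s \<longleftrightarrow> (\<forall>i\<in>{1, 2, 4, 5}. 0 \<le> y $ x i \<and> y $ x i \<le> real r) \<and>
    0 \<le> y $ x 3 \<and> y $ x 3 \<le> real s \<and> y $ x 1 + y $ x 3 + y $ x 5 \<le> 2 * real r"
proof -
  have range: "{1..n} = {1, 2, 3, 4, 5}" using n by auto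
  have neq: "x 1 \<noteq> x 3" "x 2 \<noteq> x 3" "x 4 \<noteq> x 3" "x 5 \<noteq> x 3" "x 1 \<noteq> x 5"
    using n by (simp_all add: x_eq_iff)
  have "(\<Sum>i\<in>x ` {1, 3, 5}. y $ i) = y $ x 1 + y $ x 3 + y $ x 5" using neq by auto
  then show ?thesis
    unfolding five_box_def truncated_box_def mem_Collect_eq
    by (subst all_x_iff, unfold range) (use neq in auto)
qed

lemma gorenstein_D_polytopes_odd:
  assumes "odd n" "n \<noteq> 5"
  shows "gorenstein_D_polytopes TYPE('k::field) (path_edges x) = {}"
proof (intro equals0I)
  fix P assume "P \<in> gorenstein_D_polytopes TYPE('k) (path_edges x)"
  then show False
    using assms gorenstein_path.odd_n_five by (metis gorenstein_pathE)
qed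

end

theorem theorem6p5:
  fixes n :: nat and x :: "nat \<Rightarrow> 'n::finite"
  assumes "n = CARD('n)" and "n \<ge> 3"
    and "bij_betw x {1..n} UNIV"
  shows "(n \<ge> 4 \<and> even n \<longrightarrow>
            gorenstein_D_polytopes TYPE('k::field) (path_edges x) =
              {unit_cube, (\<lambda>y. y + (\<chi> i. 1)) ` centred_cube})
       \<and> (n = 5 \<longrightarrow>
            gorenstein_D_polytopes TYPE('k) (path_edges x) =
              {{y :: real ^ 'n. (\<forall>i\<in>{1..5}. 0 \<le> y $ x i \<and> y $ x i \<le> 1)
                   \<and> y $ x 1 + y $ x 3 + y $ x 5 \<le> 2},
               {y. (\<forall>i\<in>{1,2,4,5}. 0 \<le> y $ x i \<and> y $ x i \<le> 1) \<and> 0 \<le> y $ x 3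
                   \<and> y $ x 1 + y $ x 3 + y $ x 5 \<le> 2},
               {y. (\<forall>i\<in>{1..5}. 0 \<le> y $ x i \<and> y $ x i \<le> 2)
                   \<and> y $ x 1 + y $ x 3 + y $ x 5 \<le> 4},
               {y. (\<forall>i\<in>{1,2,4,5}. 0 \<le> y $ x i \<and> y $ x i \<le> 2) \<and> 0 \<le> y $ x 3
                   \<and> y $ x 1 + y $ x 3 + y $ x 5 \<le> 4}})
       \<and> (odd n \<and> n \<noteq> 5 \<longrightarrow>
            gorenstein_D_polytopes TYPE('k) (path_edges x) = {})"
proof -
  interpret path_labelling n x using assms by unfold_locales
  show ?thesis
  proof (intro conjI impI)
    assume "n = 5"
    then have n: "n \<le> 5" "5 \<le> n" by simp_all
    have range: "{1..5} = {1, 2, 3, 4, 5 :: nat}" by auto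
    \<comment> \<open>For \<open>five_box 1 2\<close> and \<open>five_box 2 4\<close> the bound on
      the third coordinate disappears, as it follows from the sum and the signs of the first and
      fifth coordinates.\<close>
    have "five_box 1 1 = {y. (\<forall>i\<in>{1..5}. 0 \<le> y $ x i \<and> y $ x i \<le> 1)
        \<and> y $ x 1 + y $ x 3 + y $ x 5 \<le> 2}"
      "five_box 1 2 = {y. (\<forall>i\<in>{1,2,4,5}. 0 \<le> y $ x i \<and> y $ x i \<le> 1) \<and> 0 \<le> y $ x 3
        \<and> y $ x 1 + y $ x 3 + y $ x 5 \<le> 2}"
      "five_box 2 2 = {y. (\<forall>i\<in>{1..5}. 0 \<le> y $ x i \<and> y $ x i \<le> 2)
        \<and> y $ x 1 + y $ x 3 + y $ x 5 \<le> 4}"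
      "five_box 2 4 = {y. (\<forall>i\<in>{1,2,4,5}. 0 \<le> y $ x i \<and> y $ x i \<le> 2) \<and> 0 \<le> y $ x 3
        \<and> y $ x 1 + y $ x 3 + y $ x 5 \<le> 4}"
      unfolding range by (auto simp: mem_five_box[OF n])
    then show "gorenstein_D_polytopes TYPE('k) (path_edges x) =
              {{y :: real ^ 'n. (\<forall>i\<in>{1..5}. 0 \<le> y $ x i \<and> y $ x i \<le> 1)
                   \<and> y $ x 1 + y $ x 3 + y $ x 5 \<le> 2},
               {y. (\<forall>i\<in>{1,2,4,5}. 0 \<le> y $ x i \<and> y $ x i \<le> 1) \<and> 0 \<le> y $ x 3
                   \<and> y $ x 1 + y $ x 3 + y $ x 5 \<le> 2},
               {y. (\<forall>i\<in>{1..5}. 0 \<le> y $ x i \<and> y $ x i \<le> 2)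
                   \<and> y $ x 1 + y $ x 3 + y $ x 5 \<le> 4},
               {y. (\<forall>i\<in>{1,2,4,5}. 0 \<le> y $ x i \<and> y $ x i \<le> 2) \<and> 0 \<le> y $ x 3
                   \<and> y $ x 1 + y $ x 3 + y $ x 5 \<le> 4}}"
      unfolding gorenstein_D_polytopes_five[OF n] by (simp only:)
  next
    assume "n \<ge> 4 \<and> even n"
    then show "gorenstein_D_polytopes TYPE('k) (path_edges x) =
        {unit_cube, (\<lambda>y. y + (\<chi> i. 1)) ` centred_cube}"
      unfolding unit_cube_box shifted_centred_cube_box by (intro gorenstein_D_polytopes_even) blast
  next
    assume "odd n \<and> n \<noteq> 5"
    then show "gorenstein_D_polytopes TYPE('k) (path_edges x) = {}"
      by (intro gorenstein_D_polytopes_odd) blast+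
  qed
qed

end
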